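(* Let $\tau_1$ and $\tau_2$ be two hyperbolic triples. Then there exists a constant $c=c(\tau_1,\tau_2)$, depending only on the types $\tau_1,\tau_2$, such that for every odd prime $p$, $$h(\mathrm{PSL}(2,p);\tau_1,\tau_2)\le c,$$ where $h(\mathrm{PSL}(2,p);\tau_1,\tau_2)$ is the number of Beauville surfaces with group $\mathrm{PSL}(2,p)$ and with types $(\tau_1,\tau_2)$.
   Context: A triple $(r,s,t)\in\mathbb{N}^3$ is hyperbolic if $\frac1r+\frac1s+\frac1t<1$. Surfaces. A Beauville surface (of unmixed type) is a complex surface $S=(C_1\times C_2)/G$ with $C_1,C_2$ curves of genus at least $2$ and $G$ a finite group acting freely and diagonally on $C_1\times C_2$, with no nontrivial element acting trivially on one of the factors, such that $C_i/G\cong\mathbb{P}^1$ and $C_i\to C_i/G$ is ramified over exactly $3$ points, $i=1,2$. Only unmixed surfaces are considered. Beauville surfaces are rigid, so each gives an isolated point (a connected component) of the moduli space; $h$ counts these points. Group-theoretic data. A spherical $3$-system of generators of a finite group $G$ is $T=(x_1,x_2,x_3)\in G^3$ with $\langle x_1,x_2,x_3\rangle=G$ and $x_1x_2x_3=1$. It has type $(m_1,m_2,m_3)$ if $\mathrm{ord}(x_i)=m_i$, and unordered type $(m_1,m_2,m_3)$ if this holds up to a permutation. Put $\Sigma(T)=\bigcup_{g\in G}\bigcup_{j\ge0}\bigcup_{k} g x_k^{j}g^{-1}$; $T_1,T_2$ are disjoint if $\Sigma(T_1)\cap\Sigma(T_2)=\{1\}$. Beauville surfaces with group $G$ and types $(\tau_1,\tau_2)$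 correspond to pairs of disjoint spherical $3$-systems of generators of $G$ of types $\tau_1,\tau_2$. The number $h(G;\tau_1,\tau_2)$ equals (by Bauer-Catanese) the number of Hurwitz components: let $\mathcal{U}(G;\tau_1,\tau_2)$ be the set of pairs $(T_1,T_2)$ of disjoint spherical $3$-systems of generators of $G$ of unordered types $\tau_1,\tau_2$. The braid group $\mathbf{B}_3=\langle\sigma_1,\sigma_2\rangle$ acts on spherical $3$-systems by $\sigma_1:(x_1,x_2,x_3)\mapsto(x_1x_2x_1^{-1},x_1,x_3)$, $\sigma_2:(x_1,x_2,x_3)\mapsto(x_1,x_2x_3x_2^{-1},x_2)$. Then $h(G;\tau_1,\tau_2)$ is the number of orbits on $\mathcal{U}(G;\tau_1,\tau_2)$ of $(\mathbf{B}_3\times\mathbf{B}_3)\times\mathrm{Aut}(G)$ acting by $((\gamma_1,\gamma_2),\phi)\cdot(T_1,T_2)=(\phi(\gamma_1(T_1)),\phi(\gamma_2(T_2)))$ if $\tau_1\ne\tau_2$, and of $(\mathbf{B}_3\wr\mathbb{Z}/2\mathbb{Z})\times\mathrm{Aut}(G)$ (with $\mathbb{Z}/2\mathbb{Z}$ exchanging $T_1$ and $T_2$) if $\tau_1=\tau_2$. *)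

theory Defs
  imports "HOL-Algebra.Group_Action" "HOL-Algebra.Elementary_Groups" "HOL-Number_Theory.Residues"
begin

section \<open>The groups \<open>PSL(2,p)\<close>\<close>

text \<open>The quadruple \<open>(a, b, c, d)\<close> is the matrix with rows \<open>(a, b)\<close> and \<open>(c, d)\<close>.\<close>

definition SL2 :: "('a, 'm) ring_scheme \<Rightarrow> ('a \<times> 'a \<times> 'a \<times> 'a) monoid" where
  "SL2 R =
    \<lparr>carrier = {(a, b, c, d). a \<in> carrier R \<and> b \<in> carrier R \<and> c \<in> carrier R \<and> d \<in> carrier R \<and>
        a \<otimes>\<^bsub>R\<^esub> d \<ominus>\<^bsub>R\<^esub> b \<otimes>\<^bsub>R\<^esub> c = \<one>\<^bsub>R\<^esub>},
     monoid.mult = (\<lambda>(a, b, c, d) (a', b', c', d').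
        (a \<otimes>\<^bsub>R\<^esub> a' \<oplus>\<^bsub>R\<^esub> b \<otimes>\<^bsub>R\<^esub> c', a \<otimes>\<^bsub>R\<^esub> b' \<oplus>\<^bsub>R\<^esub> b \<otimes>\<^bsub>R\<^esub> d',
         c \<otimes>\<^bsub>R\<^esub> a' \<oplus>\<^bsub>R\<^esub> d \<otimes>\<^bsub>R\<^esub> c', c \<otimes>\<^bsub>R\<^esub> b' \<oplus>\<^bsub>R\<^esub> d \<otimes>\<^bsub>R\<^esub> d')),
     one = (\<one>\<^bsub>R\<^esub>, \<zero>\<^bsub>R\<^esub>, \<zero>\<^bsub>R\<^esub>, \<one>\<^bsub>R\<^esub>)\<rparr>"

definition PSL2 :: "('a, 'm) ring_scheme \<Rightarrow> ('a \<times> 'a \<times> 'a \<times> 'a) set monoid" where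
  "PSL2 R = SL2 R Mod
     {(\<one>\<^bsub>R\<^esub>, \<zero>\<^bsub>R\<^esub>, \<zero>\<^bsub>R\<^esub>, \<one>\<^bsub>R\<^esub>), (\<ominus>\<^bsub>R\<^esub> \<one>\<^bsub>R\<^esub>, \<zero>\<^bsub>R\<^esub>, \<zero>\<^bsub>R\<^esub>, \<ominus>\<^bsub>R\<^esub> \<one>\<^bsub>R\<^esub>)}"

section \<open>Spherical systems of generators\<close>

type_synonym triple_type = "nat \<times> nat \<times> nat"
type_synonym 'a triple = "'a \<times> 'a \<times> 'a"

text \<open>The entries must be positive, since \<open>1 / 0 = 0\<close>.\<close>

definition hyperbolic :: "triple_type \<Rightarrow> bool" where
  "hyperbolic = (\<lambda>(r, s, t). 0 < r \<and> 0 < s \<and> 0 < t \<and>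
     1 / real r + 1 / real s + 1 / real t < 1)"

definition spherical_system :: "('a, 'm) monoid_scheme \<Rightarrow> 'a triple \<Rightarrow> bool" where
  "spherical_system G = (\<lambda>(x1, x2, x3).
     x1 \<in> carrier G \<and> x2 \<in> carrier G \<and> x3 \<in> carrier G \<and>
     generate G {x1, x2, x3} = carrier G \<and> x1 \<otimes>\<^bsub>G\<^esub> x2 \<otimes>\<^bsub>G\<^esub> x3 = \<one>\<^bsub>G\<^esub>)"

text \<open>Two triples are permutations of each other iff they have the same multiset of entries.\<close>

definition unordered :: "triple_type \<Rightarrow> nat multiset" where
  "unordered = (\<lambda>(r, s, t). {#r, s, t#})"

definition unordered_type :: "('a, 'm) monoid_scheme \<Rightarrow> 'a triple \<Rightarrow> nat multiset" where
  "unordered_type G = (\<lambda>(x1, x2, x3). {#group.ord G x1, group.ord G x2, group.ord G x3#})"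

definition Sigma_set :: "('a, 'm) monoid_scheme \<Rightarrow> 'a triple \<Rightarrow> 'a set" where
  "Sigma_set G = (\<lambda>(x1, x2, x3).
     (\<Union>g\<in>carrier G. \<Union>j::nat. \<Union>x\<in>{x1, x2, x3}. {g \<otimes>\<^bsub>G\<^esub> x [^]\<^bsub>G\<^esub> j \<otimes>\<^bsub>G\<^esub> inv\<^bsub>G\<^esub> g}))"

definition disjoint_systems :: "('a, 'm) monoid_scheme \<Rightarrow> 'a triple \<Rightarrow> 'a triple \<Rightarrow> bool" where
  "disjoint_systems G T1 T2 \<longleftrightarrow> Sigma_set G T1 \<inter> Sigma_set G T2 = {\<one>\<^bsub>G\<^esub>}"

definition disjoint_pairs ::
  "('a, 'm) monoid_scheme \<Rightarrow> triple_type \<Rightarrow> triple_type \<Rightarrow> ('a triple \<times> 'a triple) set" where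
  "disjoint_pairs G \<tau>1 \<tau>2 = {(T1, T2).
     spherical_system G T1 \<and> unordered_type G T1 = unordered \<tau>1 \<and>
     spherical_system G T2 \<and> unordered_type G T2 = unordered \<tau>2 \<and>
     disjoint_systems G T1 T2}"

section \<open>The braid group on three strands\<close>

datatype braid_gen = Sigma1 | Sigma2

text \<open>In a word, \<open>(s, False)\<close> stands for the generator \<open>s\<close> and \<open>(s, True)\<close> for its inverse.\<close>

type_synonym braid_word = "(braid_gen \<times> bool) list"

inductive braid_eq :: "braid_word \<Rightarrow> braid_word \<Rightarrow> bool" where
  refl: "braid_eq u u"
| sym: "braid_eq u v \<Longrightarrow> braid_eq v u"
| trans: "braid_eq u v \<Longrightarrow> braid_eq v w \<Longrightarrow> braid_eq u w"
| cong: "braid_eq u v \<Longrightarrow> braid_eq (p @ u @ q) (p @ v @ q)"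
| cancel: "braid_eq [(s, e), (s, \<not> e)] []"
| braid: "braid_eq [(Sigma1, False), (Sigma2, False), (Sigma1, False)]
                   [(Sigma2, False), (Sigma1, False), (Sigma2, False)]"

definition braid_rel :: "(braid_word \<times> braid_word) set" where
  "braid_rel = {(u, v). braid_eq u v}"

definition B3 :: "braid_word set monoid" where
  "B3 = \<lparr>carrier = UNIV // braid_rel,
         monoid.mult = (\<lambda>A B. \<Union>u\<in>A. \<Union>v\<in>B. braid_rel `` {u @ v}),
         one = braid_rel `` {[]}\<rparr>"

fun letter_act :: "('a, 'm) monoid_scheme \<Rightarrow> braid_gen \<times> bool \<Rightarrow> 'a triple \<Rightarrow> 'a triple" where
  "letter_act G (Sigma1, False) (x1, x2, x3) = (x1 \<otimes>\<^bsub>G\<^esub> x2 \<otimes>\<^bsub>G\<^esub> inv\<^bsub>G\<^esub> x1, x1, x3)"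
| "letter_act G (Sigma1, True) (x1, x2, x3) = (x2, inv\<^bsub>G\<^esub> x2 \<otimes>\<^bsub>G\<^esub> x1 \<otimes>\<^bsub>G\<^esub> x2, x3)"
| "letter_act G (Sigma2, False) (x1, x2, x3) = (x1, x2 \<otimes>\<^bsub>G\<^esub> x3 \<otimes>\<^bsub>G\<^esub> inv\<^bsub>G\<^esub> x2, x2)"
| "letter_act G (Sigma2, True) (x1, x2, x3) = (x1, x3, inv\<^bsub>G\<^esub> x3 \<otimes>\<^bsub>G\<^esub> x2 \<otimes>\<^bsub>G\<^esub> x3)"

definition word_act :: "('a, 'm) monoid_scheme \<Rightarrow> braid_word \<Rightarrow> 'a triple \<Rightarrow> 'a triple" where
  "word_act G w = foldr (letter_act G) w"

text \<open>On triples of elements of a group the choice of a representative does not matter;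
  see \<open>braid_act_class\<close> below.\<close>

definition braid_act :: "('a, 'm) monoid_scheme \<Rightarrow> braid_word set \<Rightarrow> 'a triple \<Rightarrow> 'a triple" where
  "braid_act G A = word_act G (SOME w. w \<in> A)"

lemma word_act_Nil: "word_act G [] T = T" by (simp add: word_act_def)
lemma word_act_append: "word_act G (u @ v) T = word_act G u (word_act G v T)"
  by (simp add: word_act_def)

context group
begin

lemma letter_act_closed:
  "T \<in> carrier G \<times> carrier G \<times> carrier G \<Longrightarrow>
   letter_act G l T \<in> carrier G \<times> carrier G \<times> carrier G"
  by (cases "(G, l, T)" rule: letter_act.cases) auto

lemma word_act_closed:
  "T \<in> carrier G \<times> carrier G \<times> carrier G \<Longrightarrow>
   word_act G w T \<in> carrier G \<times> carrier G \<times> carrier G"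
proof (induction w)
  case (Cons l w)
  then show ?case using letter_act_closed[of "word_act G w T" l] by (simp add: word_act_def)
qed (simp add: word_act_def)

lemma mult_inv_cancel:
  assumes "x \<in> carrier G" "y \<in> carrier G"
  shows "x \<otimes> (inv x \<otimes> y) = y" and "inv x \<otimes> (x \<otimes> y) = y"
  using assms by (simp_all flip: m_assoc)

lemma word_act_cong:
  assumes "braid_eq u v" "T \<in> carrier G \<times> carrier G \<times> carrier G"
  shows "word_act G u T = word_act G v T"
  using assms
proof (induction arbitrary: T rule: braid_eq.induct)
  case (cong u v p q)
  then show ?case using word_act_closed by (simp add: word_act_append)
next
  case (cancel s e)
  then show ?case
    by (cases s; cases e) (auto simp: word_act_def m_assoc mult_inv_cancel)
next
  case braid
  then show ?case by (auto simp: word_act_def inv_mult_group m_assoc mult_inv_cancel)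
qed simp_all

lemma braid_act_class:
  assumes "T \<in> carrier G \<times> carrier G \<times> carrier G"
  shows "braid_act G (braid_rel `` {w}) T = word_act G w T"
proof -
  have "braid_eq w (SOME w'. w' \<in> braid_rel `` {w})"
    using someI[of "\<lambda>w'. w' \<in> braid_rel `` {w}" w] braid_eq.refl by (simp add: braid_rel_def)
  then show ?thesis
    using word_act_cong[OF _ assms] by (simp add: braid_act_def)
qed

end

lemma equiv_braid_rel: "equiv UNIV braid_rel"
proof (rule equivI)
  show "refl_on UNIV braid_rel" by (simp add: refl_on_def braid_rel_def braid_eq.refl)
  show "sym braid_rel" by (simp add: sym_def braid_rel_def braid_eq.sym)
  show "trans braid_rel" unfolding trans_def braid_rel_def using braid_eq.trans by blast
qed simp

lemma braid_eq_append:
  assumes "braid_eq u u'" "braid_eq v v'" shows "braid_eq (u @ v) (u' @ v')"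
  using braid_eq.cong[OF assms(1), of "[]" v] braid_eq.cong[OF assms(2), of u' "[]"]
  by (metis append_Nil append_Nil2 braid_eq.trans)

lemma B3_mult: "(braid_rel `` {u}) \<otimes>\<^bsub>B3\<^esub> (braid_rel `` {v}) = braid_rel `` {u @ v}"
proof -
  have "braid_rel `` {u' @ v'} = braid_rel `` {u @ v}"
    if "u' \<in> braid_rel `` {u}" "v' \<in> braid_rel `` {v}" for u' v'
  proof -
    have "(u @ v, u' @ v') \<in> braid_rel"
      using that braid_eq_append by (simp add: braid_rel_def)
    then show ?thesis by (rule equiv_class_eq[OF equiv_braid_rel, symmetric])
  qed
  then have "(braid_rel `` {u}) \<otimes>\<^bsub>B3\<^esub> (braid_rel `` {v}) =
      (\<Union>u'\<in>braid_rel `` {u}. \<Union>v'\<in>braid_rel `` {v}. braid_rel `` {u @ v})"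
    by (simp add: B3_def)
  moreover have "braid_rel `` {u} \<noteq> {}" "braid_rel `` {v} \<noteq> {}"
    using braid_eq.refl by (auto simp: braid_rel_def)
  ultimately show ?thesis by (simp only: UN_constant if_False)
qed

lemma B3_inv: "braid_eq (rev (map (\<lambda>(s,e). (s, \<not> e)) w) @ w) []"
proof (induction w)
  case (Cons a w)
  obtain s e where a: "a = (s,e)" by fastforce
  let ?r = "rev (map (\<lambda>(s,e). (s, \<not> e)) w)"
  have "braid_eq (?r @ [(s, \<not> e), (s, \<not> \<not> e)] @ w) (?r @ [] @ w)"
    by (rule braid_eq.cong[OF braid_eq.cancel])
  then have "braid_eq (?r @ [(s, \<not> e), (s, e)] @ w) (?r @ w)" by simp
  from braid_eq.trans[OF this Cons] show ?case by (simp add: a)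
qed (simp add: braid_eq.refl)

lemma group_B3: "group B3"
proof (rule groupI)
  have C: "\<exists>w. A = braid_rel `` {w}" if "A \<in> carrier B3" for A
    using that by (auto simp: B3_def quotient_def)
  have D: "braid_rel `` {w} \<in> carrier B3" for w
    by (auto simp: B3_def quotient_def)
  have O: "\<one>\<^bsub>B3\<^esub> = braid_rel `` {[]}" by (simp add: B3_def)
  show "\<And>x y. x \<in> carrier B3 \<Longrightarrow> y \<in> carrier B3 \<Longrightarrow> x \<otimes>\<^bsub>B3\<^esub> y \<in> carrier B3"
    using C D B3_mult by metis
  show "\<one>\<^bsub>B3\<^esub> \<in> carrier B3" using O D by simp
  show "\<And>x y z. \<lbrakk>x \<in> carrier B3; y \<in> carrier B3; z \<in> carrier B3\<rbrakk>
       \<Longrightarrow> x \<otimes>\<^bsub>B3\<^esub> y \<otimes>\<^bsub>B3\<^esub> z = x \<otimes>\<^bsub>B3\<^esub> (y \<otimes>\<^bsub>B3\<^esub> z)"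
    using C B3_mult append_assoc by metis
  show "\<And>x. x \<in> carrier B3 \<Longrightarrow> \<one>\<^bsub>B3\<^esub> \<otimes>\<^bsub>B3\<^esub> x = x"
    using C B3_mult O append_Nil by metis
  show "\<exists>y\<in>carrier B3. y \<otimes>\<^bsub>B3\<^esub> x = \<one>\<^bsub>B3\<^esub>" if "x \<in> carrier B3" for x
  proof -
    from C[OF that] obtain w where w: "x = braid_rel `` {w}" ..
    let ?v = "rev (map (\<lambda>(s, e). (s, \<not> e)) w)"
    have "(?v @ w, []) \<in> braid_rel" using B3_inv by (simp add: braid_rel_def)
    then have "(braid_rel `` {?v}) \<otimes>\<^bsub>B3\<^esub> x = \<one>\<^bsub>B3\<^esub>"
      using equiv_class_eq[OF equiv_braid_rel] by (simp only: w O B3_mult)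
    then show ?thesis using D by blast
  qed
qed

section \<open>Hurwitz components\<close>

text \<open>The wreath product of \<open>H\<close> with \<open>Z/2Z\<close>: the semidirect product of \<open>H \<times> H\<close> with
  \<open>Z/2Z\<close>, whose nontrivial element exchanges the two factors.\<close>

definition wreath2 :: "('a, 'm) monoid_scheme \<Rightarrow> (('a \<times> 'a) \<times> int) monoid" where
  "wreath2 H =
    \<lparr>carrier = carrier ((H \<times>\<times> H) \<times>\<times> integer_mod_group 2),
     monoid.mult = (\<lambda>((a1, a2), e) (b, f).
       ((a1, a2) \<otimes>\<^bsub>H \<times>\<times> H\<^esub> (if e = 0 then b else prod.swap b), e \<otimes>\<^bsub>integer_mod_group 2\<^esub> f)),
     one = \<one>\<^bsub>(H \<times>\<times> H) \<times>\<times> integer_mod_group 2\<^esub>\<rparr>"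

lemma group_wreath2: assumes "group H" shows "group (wreath2 H)"
proof (rule groupI)
  interpret H: group H by fact
  have 2: "carrier (integer_mod_group 2) = {0,1}" by (auto simp: carrier_integer_mod_group)
  show "\<And>x y. x \<in> carrier (wreath2 H) \<Longrightarrow> y \<in> carrier (wreath2 H) \<Longrightarrow> x \<otimes>\<^bsub>wreath2 H\<^esub> y \<in> carrier (wreath2 H)"
    by (auto simp: wreath2_def 2 DirProd_def)
  show "\<one>\<^bsub>wreath2 H\<^esub> \<in> carrier (wreath2 H)" by (auto simp: wreath2_def 2 DirProd_def)
  show "\<And>x y z. \<lbrakk>x \<in> carrier (wreath2 H); y \<in> carrier (wreath2 H); z \<in> carrier (wreath2 H)\<rbrakk>
       \<Longrightarrow> x \<otimes>\<^bsub>wreath2 H\<^esub> y \<otimes>\<^bsub>wreath2 H\<^esub> z = x \<otimes>\<^bsub>wreath2 H\<^esub> (y \<otimes>\<^bsub>wreath2 H\<^esub> z)"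
    by (auto simp: wreath2_def 2 DirProd_def H.m_assoc)
  show "\<And>x. x \<in> carrier (wreath2 H) \<Longrightarrow> \<one>\<^bsub>wreath2 H\<^esub> \<otimes>\<^bsub>wreath2 H\<^esub> x = x"
    by (auto simp: wreath2_def 2 DirProd_def)
  show "\<exists>y\<in>carrier (wreath2 H). y \<otimes>\<^bsub>wreath2 H\<^esub> x = \<one>\<^bsub>wreath2 H\<^esub>" if "x \<in> carrier (wreath2 H)" for x
  proof -
    obtain a b e where x: "x = ((a,b),e)" by (metis surj_pair)
    show ?thesis using that x
      by (intro bexI[of _ "(if e = 0 then (inv\<^bsub>H\<^esub> a, inv\<^bsub>H\<^esub> b) else (inv\<^bsub>H\<^esub> b, inv\<^bsub>H\<^esub> a), e)"])
         (auto simp: wreath2_def 2 DirProd_def)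
  qed
qed

definition map_triple :: "('a \<Rightarrow> 'b) \<Rightarrow> 'a triple \<Rightarrow> 'b triple" where
  "map_triple f = map_prod f (map_prod f f)"

definition hurwitz_act :: "('a, 'm) monoid_scheme \<Rightarrow>
    (braid_word set \<times> braid_word set) \<times> ('a \<Rightarrow> 'a) \<Rightarrow>
    'a triple \<times> 'a triple \<Rightarrow> 'a triple \<times> 'a triple" where
  "hurwitz_act G = (\<lambda>((g1, g2), f) (T1, T2).
     (map_triple f (braid_act G g1 T1), map_triple f (braid_act G g2 T2)))"

definition hurwitz_act_swap :: "('a, 'm) monoid_scheme \<Rightarrow>
    ((braid_word set \<times> braid_word set) \<times> int) \<times> ('a \<Rightarrow> 'a) \<Rightarrow>
    'a triple \<times> 'a triple \<Rightarrow> 'a triple \<times> 'a triple" where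
  "hurwitz_act_swap G = (\<lambda>((g, e), f) T.
     hurwitz_act G (g, f) (if e = 0 then T else prod.swap T))"

text \<open>The number of Beauville surfaces with group \<open>G\<close> and types \<open>(\<tau>1, \<tau>2)\<close>, as the number of
  Hurwitz components (Bauer--Catanese).  The set acted upon depends only on the unordered types,
  so these are what is compared.  The restriction to that set only serves to obtain a
  group action in the sense of the locale \<open>group_action\<close>.\<close>

definition num_beauville ::
  "('a, 'm) monoid_scheme \<Rightarrow> triple_type \<Rightarrow> triple_type \<Rightarrow> nat" where
  "num_beauville G \<tau>1 \<tau>2 =
    (let U = disjoint_pairs G \<tau>1 \<tau>2 in
     if unordered \<tau>1 = unordered \<tau>2
     then card (orbits (wreath2 B3 \<times>\<times> AutoGroup G) U (\<lambda>a. restrict (hurwitz_act_swap G a) U))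
     else card (orbits ((B3 \<times>\<times> B3) \<times>\<times> AutoGroup G) U (\<lambda>a. restrict (hurwitz_act G a) U)))"

end

theory Submission
  imports Defs "HOL-Computational_Algebra.Polynomial"
begin

text \<open>The braid group acts on each of the two systems separately, and on a system of generators with
product \<open>1\<close> it realises conjugation by every element of the group: moving the first (or the last)
point once around the others conjugates the whole triple by its first (or last) entry, and these
two entries generate.  This is \<open>conj_is_braid\<close>.  Hence a Hurwitz orbit is a union of orbits of
\<open>G \<times> G\<close> acting by conjugation on the two systems independently.  If the centre of \<open>G\<close> is trivial
the latter action is free, because only central elements commute with generators, so
\<open>h(G; \<tau>1, \<tau>2) * |G|^2 \<le> |X1| * |X2|\<close>, where \<open>Xi\<close> is the set of all spherical systems of
type \<open>\<tau>i\<close> (\<open>num_beauville_le\<close>).  Automorphisms can only merge orbits further.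

For \<open>G = PSL(2,p)\<close> one has \<open>|G| \<ge> p^3 / 3\<close>, so everything follows from \<open>|X| = O(p^3)\<close> with a
constant depending on the type \<open>(r, s, t)\<close> alone.  A system is determined by its first two entries;
lift these to matrices \<open>A, B\<close> of determinant \<open>1\<close>.  Hyperbolicity forces \<open>r, s, t > 1\<close>, so \<open>A\<close>,
\<open>B\<close> and \<open>AB\<close> are not \<open>\<plusminus>1\<close>, while a power of each with exponent \<open>r\<close>, \<open>s\<close> or \<open>t\<close> is.  By the
Cayley-Hamilton theorem \<open>A^m = S_m(tr A) A - S_(m-1)(tr A)\<close> for monic integer polynomials \<open>S_m\<close>
of degree \<open>m - 1\<close>, hence \<open>S_m(tr A) = 0\<close> in the field with \<open>p\<close> elements
(\<open>trace_of_finite_order\<close>).  So the three traces lie in a set of at most \<open>r + s + t\<close> elements.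
For a prescribed trace there are at most \<open>2 p^2\<close> matrices \<open>A\<close>; for each non-scalar \<open>A\<close>, the
conditions on \<open>tr B\<close> and \<open>tr (AB)\<close> cut out a plane in which \<open>det B = 1\<close> is a conic, giving at
most \<open>2 p\<close> matrices \<open>B\<close> (\<open>card_partners_le\<close>).\<close>

section \<open>Conjugation by braids, and orbits of Hurwitz moves\<close>

definition conj_triple :: "('a, 'm) monoid_scheme \<Rightarrow> 'a \<Rightarrow> 'a triple \<Rightarrow> 'a triple" where
  "conj_triple G g = map_triple (\<lambda>x. g \<otimes>\<^bsub>G\<^esub> x \<otimes>\<^bsub>G\<^esub> inv\<^bsub>G\<^esub> g)"

definition systems_of_type :: "('a, 'm) monoid_scheme \<Rightarrow> triple_type \<Rightarrow> 'a triple set" where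
  "systems_of_type G \<tau> = {T. spherical_system G T \<and> unordered_type G T = unordered \<tau>}"

context group
begin

lemma conj_triple_simp:
  "conj_triple G g (x1, x2, x3) = (g \<otimes> x1 \<otimes> inv g, g \<otimes> x2 \<otimes> inv g, g \<otimes> x3 \<otimes> inv g)"
  by (simp add: conj_triple_def map_triple_def)

lemma conj_triple_mult:
  assumes "T \<in> carrier G \<times> carrier G \<times> carrier G" "g \<in> carrier G" "h \<in> carrier G"
  shows "conj_triple G (g \<otimes> h) T = conj_triple G g (conj_triple G h T)"
  using assms by (auto simp: conj_triple_simp m_assoc inv_mult_group)

lemma conj_triple_closed:
  assumes "T \<in> carrier G \<times> carrier G \<times> carrier G" "g \<in> carrier G"
  shows "conj_triple G g T \<in> carrier G \<times> carrier G \<times> carrier G"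
  using assms by (auto simp: conj_triple_simp)

lemma conj_triple_one:
  assumes "T \<in> carrier G \<times> carrier G \<times> carrier G"
  shows "conj_triple G \<one> T = T"
  using assms by (auto simp: conj_triple_simp)

lemma conj_group_hom:
  assumes "g \<in> carrier G"
  shows "group_hom G G (\<lambda>x. g \<otimes> x \<otimes> inv g)"
  by (intro group_hom.intro group_hom_axioms.intro homI is_group)
    (use assms in \<open>auto simp: m_assoc mult_inv_cancel\<close>)

lemma conj_image_carrier:
  assumes "g \<in> carrier G"
  shows "(\<lambda>x. g \<otimes> x \<otimes> inv g) ` carrier G = carrier G"
proof
  show "carrier G \<subseteq> (\<lambda>x. g \<otimes> x \<otimes> inv g) ` carrier G"
  proof
    fix y assume "y \<in> carrier G"
    then show "y \<in> (\<lambda>x. g \<otimes> x \<otimes> inv g) ` carrier G"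
      using assms by (intro image_eqI[of _ _ "inv g \<otimes> y \<otimes> g"]) (auto simp: m_assoc mult_inv_cancel)
  qed
qed (use assms in auto)

lemma pow_conj:
  assumes "g \<in> carrier G" "x \<in> carrier G"
  shows "(g \<otimes> x \<otimes> inv g) [^] (n::nat) = g \<otimes> x [^] n \<otimes> inv g"
  using group_hom.hom_nat_pow[OF conj_group_hom[OF assms(1)] assms(2), of n] by simp

lemma conj_eq_one_iff:
  assumes "g \<in> carrier G" "x \<in> carrier G"
  shows "g \<otimes> x \<otimes> inv g = \<one> \<longleftrightarrow> x = \<one>"
  using assms by (metis inv_closed inv_solve_right' l_one m_closed r_one l_cancel_one)

lemma ord_conj:
  assumes "g \<in> carrier G" "x \<in> carrier G"
  shows "ord (g \<otimes> x \<otimes> inv g) = ord x"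
proof -
  have "((g \<otimes> x \<otimes> inv g) [^] n = \<one>) = (x [^] n = \<one>)" for n :: nat
    using assms by (simp add: pow_conj conj_eq_one_iff)
  then show ?thesis using assms by (simp add: ord_unique pow_eq_id)
qed

lemma spherical_system_carrier:
  "spherical_system G T \<Longrightarrow> T \<in> carrier G \<times> carrier G \<times> carrier G"
  by (auto simp: spherical_system_def)

lemma spherical_system_conj:
  assumes T: "spherical_system G T" and g: "g \<in> carrier G"
  shows "spherical_system G (conj_triple G g T)"
proof -
  obtain x1 x2 x3 where T': "T = (x1, x2, x3)" by (cases T) auto
  let ?c = "\<lambda>x. g \<otimes> x \<otimes> inv g"
  have x: "x1 \<in> carrier G" "x2 \<in> carrier G" "x3 \<in> carrier G"
    and gen: "generate G {x1, x2, x3} = carrier G" and prod: "x1 \<otimes> x2 \<otimes> x3 = \<one>"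
    using T by (auto simp: T' spherical_system_def)
  interpret c: group_hom G G ?c by (rule conj_group_hom[OF g])
  have "generate G (?c ` {x1, x2, x3}) = ?c ` generate G {x1, x2, x3}"
    using x by (subst c.generate_img) auto
  then have "generate G {?c x1, ?c x2, ?c x3} = carrier G"
    by (simp add: gen conj_image_carrier[OF g])
  moreover have "?c x1 \<otimes> ?c x2 \<otimes> ?c x3 = \<one>"
    using x g prod c.hom_mult[of "x1 \<otimes> x2" x3] c.hom_mult[of x1 x2] by simp
  ultimately show ?thesis
    using x g by (auto simp: T' spherical_system_def conj_triple_simp)
qed

lemma unordered_type_conj:
  assumes "T \<in> carrier G \<times> carrier G \<times> carrier G" "g \<in> carrier G"
  shows "unordered_type G (conj_triple G g T) = unordered_type G T"
  using assms by (auto simp: unordered_type_def conj_triple_simp ord_conj)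

lemma Sigma_set_conj_subset:
  assumes T: "T \<in> carrier G \<times> carrier G \<times> carrier G" and g: "g \<in> carrier G"
  shows "Sigma_set G (conj_triple G g T) \<subseteq> Sigma_set G T"
proof
  fix z assume z: "z \<in> Sigma_set G (conj_triple G g T)"
  obtain x1 x2 x3 where T': "T = (x1, x2, x3)" by (cases T) auto
  have x: "{x1, x2, x3} \<subseteq> carrier G" using T by (auto simp: T')
  obtain h j x where h: "h \<in> carrier G" "x \<in> {x1, x2, x3}"
    and z: "z = h \<otimes> (g \<otimes> x \<otimes> inv g) [^] (j::nat) \<otimes> inv h"
    using z by (auto simp: T' Sigma_set_def conj_triple_simp)
  have "x \<in> carrier G" using h x by auto
  then have "z = (h \<otimes> g) \<otimes> x [^] j \<otimes> inv (h \<otimes> g)"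
    using h(1) g unfolding z by (simp only: pow_conj) (simp add: m_assoc inv_mult_group)
  with h g show "z \<in> Sigma_set G T" by (auto simp: T' Sigma_set_def)
qed

lemma Sigma_set_conj:
  assumes T: "T \<in> carrier G \<times> carrier G \<times> carrier G" and g: "g \<in> carrier G"
  shows "Sigma_set G (conj_triple G g T) = Sigma_set G T"
proof
  have "conj_triple G (inv g) (conj_triple G g T) = T"
    using T g by (simp add: conj_triple_one flip: conj_triple_mult)
  then show "Sigma_set G T \<subseteq> Sigma_set G (conj_triple G g T)"
    using Sigma_set_conj_subset[of "conj_triple G g T" "inv g"] conj_triple_closed[OF T g] g by simp
qed (rule Sigma_set_conj_subset[OF assms])

lemma disjoint_pairs_conj:
  assumes "(T1, T2) \<in> disjoint_pairs G \<tau>1 \<tau>2" "g1 \<in> carrier G" "g2 \<in> carrier G"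
  shows "(conj_triple G g1 T1, conj_triple G g2 T2) \<in> disjoint_pairs G \<tau>1 \<tau>2"
  using assms spherical_system_carrier
  by (auto simp: disjoint_pairs_def disjoint_systems_def spherical_system_conj
      unordered_type_conj Sigma_set_conj)

text \<open>The first point travels around the other two.  The braid conjugates the first entry by
\<open>x2 \<otimes> x3\<close> and \<open>x1\<close>, both of which commute with it, because \<open>x2 \<otimes> x3 = inv x1\<close>.\<close>

lemma word_act_conj_first:
  assumes "x1 \<in> carrier G" "x2 \<in> carrier G" "x3 \<in> carrier G" "x1 \<otimes> x2 \<otimes> x3 = \<one>"
  shows "word_act G [(Sigma1, False), (Sigma2, False), (Sigma2, False), (Sigma1, False)] (x1, x2, x3)
    = conj_triple G x1 (x1, x2, x3)"
proof -
  have "x1 = inv (x2 \<otimes> x3)" using assms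
    by (metis inv_equality m_assoc m_closed)
  then have x3: "x3 = inv x2 \<otimes> inv x1"
    using assms by (metis inv_closed inv_mult_group inv_solve_left' m_closed inv_inv)
  show ?thesis
    unfolding x3 using assms
    by (simp add: word_act_def conj_triple_simp m_assoc mult_inv_cancel inv_mult_group)
qed

lemma word_act_conj_last:
  assumes "x1 \<in> carrier G" "x2 \<in> carrier G" "x3 \<in> carrier G" "x1 \<otimes> x2 \<otimes> x3 = \<one>"
  shows "word_act G [(Sigma2, False), (Sigma1, False), (Sigma1, False), (Sigma2, False)] (x1, x2, x3)
    = conj_triple G x3 (x1, x2, x3)"
proof -
  have x3: "x3 = inv x2 \<otimes> inv x1"
    using assms by (metis inv_closed inv_mult_group inv_equality m_assoc m_closed inv_inv)
  show ?thesis
    unfolding x3 using assms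
    by (simp add: word_act_def conj_triple_simp m_assoc mult_inv_cancel inv_mult_group)
qed

lemma word_act_left_inverse:
  assumes "T \<in> carrier G \<times> carrier G \<times> carrier G"
  shows "\<exists>w'. word_act G w' (word_act G w T) = T"
  using word_act_cong[OF B3_inv[of w] assms] by (metis word_act_append word_act_Nil)

text \<open>The set of elements whose conjugation is a braid is closed under right multiplication by the first
and last entries \<open>x1, x3\<close>: a word conjugating by the first entry is applied to the triple already
conjugated by \<open>h\<close>, whose first entry is \<open>h \<otimes> x1 \<otimes> inv h\<close>, and \<open>(h \<otimes> x1 \<otimes> inv h) \<otimes> h = h \<otimes> x1\<close>.\<close>

lemma conj_is_braid:
  assumes T: "spherical_system G T" and g: "g \<in> carrier G"
  shows "\<exists>w. word_act G w T = conj_triple G g T"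
proof -
  obtain x1 x2 x3 where T': "T = (x1, x2, x3)" by (cases T) auto
  have x: "x1 \<in> carrier G" "x2 \<in> carrier G" "x3 \<in> carrier G"
    and gen: "generate G {x1, x2, x3} = carrier G" and prod: "x1 \<otimes> x2 \<otimes> x3 = \<one>"
    using T by (auto simp: T' spherical_system_def)
  have TC: "T \<in> carrier G \<times> carrier G \<times> carrier G" using x by (simp add: T')
  define S where "S = {h \<in> carrier G. \<exists>w. word_act G w T = conj_triple G h T}"
  have S1: "\<one> \<in> S" using TC by (auto simp: S_def conj_triple_one intro: exI[of _ "[]"] simp: word_act_Nil)
  have act: "\<exists>w. word_act G w (conj_triple G h T) = conj_triple G (h \<otimes> y) T"
    if h: "h \<in> carrier G" and y: "y \<in> {x1, x3}" for h y
  proof -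
    let ?h = "\<lambda>x. h \<otimes> x \<otimes> inv h"
    have "?h x1 \<otimes> ?h x2 \<otimes> ?h x3 = \<one>" and hx: "?h x1 \<in> carrier G" "?h x2 \<in> carrier G" "?h x3 \<in> carrier G"
      using spherical_system_conj[OF T h] by (auto simp: T' conj_triple_simp spherical_system_def)
    then have "\<exists>w. word_act G w (conj_triple G h T) = conj_triple G (?h y) (conj_triple G h T)"
      using y word_act_conj_first[of "?h x1" "?h x2" "?h x3"] word_act_conj_last[of "?h x1" "?h x2" "?h x3"]
      by (auto simp: T' conj_triple_simp[of h])
    moreover have yc: "y \<in> carrier G" using x y by auto
    have "conj_triple G (?h y) (conj_triple G h T) = conj_triple G (?h y \<otimes> h) T"
      using TC h yc by (simp add: conj_triple_mult)
    moreover have "?h y \<otimes> h = h \<otimes> y" using h yc by (simp add: m_assoc)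
    ultimately show ?thesis by metis
  qed
  have S2: "h \<otimes> y \<in> S" if h: "h \<in> S" and y: "y \<in> {x1, x3}" for h y
  proof -
    have c: "h \<in> carrier G" "y \<in> carrier G" using h y x by (auto simp: S_def)
    obtain u v where "word_act G u T = conj_triple G h T"
      and "word_act G v (conj_triple G h T) = conj_triple G (h \<otimes> y) T"
      using h act[OF c(1) y] by (auto simp: S_def)
    then have "word_act G (v @ u) T = conj_triple G (h \<otimes> y) T" by (simp add: word_act_append)
    then show ?thesis using c by (auto simp: S_def)
  qed
  have S3: "h \<otimes> inv y \<in> S" if h: "h \<in> S" and y: "y \<in> {x1, x3}" for h y
  proof -
    have c: "h \<in> carrier G" "y \<in> carrier G" using h y x by (auto simp: S_def)
    obtain v where "word_act G v (conj_triple G (h \<otimes> inv y) T) = conj_triple G h T"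
      using act[of "h \<otimes> inv y" y] c y by (auto simp: m_assoc)
    then obtain v' where "word_act G v' (conj_triple G h T) = conj_triple G (h \<otimes> inv y) T"
      using word_act_left_inverse[OF conj_triple_closed[OF TC], of "h \<otimes> inv y" v] c by auto
    moreover obtain u where "word_act G u T = conj_triple G h T" using h by (auto simp: S_def)
    ultimately have "word_act G (v' @ u) T = conj_triple G (h \<otimes> inv y) T" by (simp add: word_act_append)
    then show ?thesis using c by (auto simp: S_def)
  qed
  \<comment> \<open>The middle entry is a word in the outer two, for which braids are at hand.\<close>
  have x2: "x2 = inv x1 \<otimes> inv x3" "inv x2 = x3 \<otimes> x1"
  proof -
    show "x2 = inv x1 \<otimes> inv x3"
      using x prod by (metis inv_closed inv_solve_left inv_solve_right' l_one m_assoc m_closed r_one)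
    then show "inv x2 = x3 \<otimes> x1" using x by (simp add: inv_mult_group)
  qed
  have "\<forall>h\<in>S. h \<otimes> k \<in> S" if "k \<in> generate G {x1, x2, x3}" for k
    using that
  proof induction
    case one
    then show ?case by (auto simp: S_def)
  next
    case (incl k)
    show ?case
    proof
      fix h assume h: "h \<in> S"
      have "h \<otimes> x2 \<in> S" using S3[OF S3[OF h, of x1], of x3] h x by (auto simp: x2(1) m_assoc S_def)
      then show "h \<otimes> k \<in> S" using incl S2[OF h] by auto
    qed
  next
    case (inv k)
    show ?case
    proof
      fix h assume h: "h \<in> S"
      have "h \<otimes> inv x2 \<in> S" using S2[OF S2[OF h, of x3], of x1] h x by (auto simp: x2(2) m_assoc S_def)
      then show "h \<otimes> inv k \<in> S" using inv S3[OF h] by auto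
    qed
  next
    case (eng k1 k2)
    then have "k1 \<in> carrier G" "k2 \<in> carrier G" using gen by auto
    with eng show ?case by (auto simp: S_def simp flip: m_assoc)
  qed
  then have "\<one> \<otimes> g \<in> S" using S1 g gen by blast
  then show ?thesis using g by (simp add: S_def)
qed

text \<open>Freeness of the conjugation action on generating triples: an element that fixes a generating triple
is central.\<close>

lemma conj_triple_inj:
  assumes T: "spherical_system G T" and g: "g \<in> carrier G" "h \<in> carrier G"
    and centre: "\<And>z. z \<in> carrier G \<Longrightarrow> (\<And>x. x \<in> carrier G \<Longrightarrow> z \<otimes> x = x \<otimes> z) \<Longrightarrow> z = \<one>"
    and eq: "conj_triple G g T = conj_triple G h T"
  shows "g = h"
proof -
  obtain x1 x2 x3 where T': "T = (x1, x2, x3)" by (cases T) auto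
  have x: "x1 \<in> carrier G" "x2 \<in> carrier G" "x3 \<in> carrier G"
    and gen: "generate G {x1, x2, x3} = carrier G"
    using T by (auto simp: T' spherical_system_def)
  have TC: "T \<in> carrier G \<times> carrier G \<times> carrier G" using x by (simp add: T')
  define z where "z = inv h \<otimes> g"
  have z: "z \<in> carrier G" using g by (simp add: z_def)
  have "conj_triple G z T = T"
    using TC g eq by (simp add: z_def conj_triple_mult[of _ "inv h" g])
      (simp add: conj_triple_one flip: conj_triple_mult)
  then have fixed: "z \<otimes> y \<otimes> inv z = y" if "y \<in> {x1, x2, x3}" for y
    using that by (auto simp: T' conj_triple_simp)
  interpret c: group_hom G G "\<lambda>x. z \<otimes> x \<otimes> inv z" by (rule conj_group_hom[OF z])
  have "y \<in> carrier G \<and> z \<otimes> y \<otimes> inv z = y" if "y \<in> generate G {x1, x2, x3}" for y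
    using that
  proof induction
    case (inv y)
    then have "y \<in> carrier G" using x by auto
    then show ?case using fixed[OF inv] c.hom_inv[of y] by simp
  next
    case (eng y1 y2)
    then show ?case using c.hom_mult[of y1 y2] by simp
  qed (use x fixed z in auto)
  then have "z \<otimes> y = y \<otimes> z" if "y \<in> carrier G" for y
    using that gen z by (metis inv_solve_right' m_closed)
  then have "z = \<one>" using z centre by blast
  then show ?thesis using g by (metis inv_equality inv_inv inv_closed z_def inv_solve_left r_one)
qed

lemma braid_act_word_act:
  assumes "a \<in> carrier B3" "T \<in> carrier G \<times> carrier G \<times> carrier G"
  shows "braid_act G a (word_act G w T) = braid_act G (a \<otimes>\<^bsub>B3\<^esub> braid_rel `` {w}) T"
proof -
  obtain v where v: "a = braid_rel `` {v}" using assms(1) by (auto simp: B3_def quotient_def)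
  show ?thesis
    unfolding v B3_mult using assms(2) by (simp add: braid_act_class word_act_closed word_act_append)
qed

lemma class_in_B3: "braid_rel `` {w} \<in> carrier B3"
  by (auto simp: B3_def quotient_def)

text \<open>Automorphisms are applied after the braids, so a preliminary conjugation, being a braid, is
absorbed into the braid component without touching \<open>f\<close>.  In the swapped action the same holds with
the two systems exchanged.\<close>

lemma hurwitz_act_conj:
  assumes T: "spherical_system G T1" "spherical_system G T2"
    and g: "g1 \<in> carrier G" "g2 \<in> carrier G"
    and a: "a1 \<in> carrier B3" "a2 \<in> carrier B3"
  obtains b1 b2 where "b1 \<in> carrier B3" "b2 \<in> carrier B3"
    and "\<And>f. hurwitz_act G ((a1, a2), f) (conj_triple G g1 T1, conj_triple G g2 T2) =
       hurwitz_act G ((b1, b2), f) (T1, T2)"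
proof -
  interpret B3: group B3 by (rule group_B3)
  obtain w1 w2 where w: "word_act G w1 T1 = conj_triple G g1 T1" "word_act G w2 T2 = conj_triple G g2 T2"
    using conj_is_braid T g by meson
  have C: "T1 \<in> carrier G \<times> carrier G \<times> carrier G" "T2 \<in> carrier G \<times> carrier G \<times> carrier G"
    using T spherical_system_carrier by auto
  show thesis
  proof (rule that)
    show "a1 \<otimes>\<^bsub>B3\<^esub> braid_rel `` {w1} \<in> carrier B3" "a2 \<otimes>\<^bsub>B3\<^esub> braid_rel `` {w2} \<in> carrier B3"
      using a class_in_B3 by auto
  qed (simp add: hurwitz_act_def w[symmetric] braid_act_word_act a C)
qed

lemma conj_orbit_subset:
  assumes P: "(T1, T2) \<in> disjoint_pairs G \<tau>1 \<tau>2" and g: "g1 \<in> carrier G" "g2 \<in> carrier G"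
  defines "U \<equiv> disjoint_pairs G \<tau>1 \<tau>2"
  shows "orbit ((B3 \<times>\<times> B3) \<times>\<times> AutoGroup G) (\<lambda>a. restrict (hurwitz_act G a) U)
      (conj_triple G g1 T1, conj_triple G g2 T2)
    \<subseteq> orbit ((B3 \<times>\<times> B3) \<times>\<times> AutoGroup G) (\<lambda>a. restrict (hurwitz_act G a) U) (T1, T2)" (is ?plain)
  and "orbit (wreath2 B3 \<times>\<times> AutoGroup G) (\<lambda>a. restrict (hurwitz_act_swap G a) U)
      (conj_triple G g1 T1, conj_triple G g2 T2)
    \<subseteq> orbit (wreath2 B3 \<times>\<times> AutoGroup G) (\<lambda>a. restrict (hurwitz_act_swap G a) U) (T1, T2)" (is ?swap)
proof -
  have T: "spherical_system G T1" "spherical_system G T2" using P by (auto simp: disjoint_pairs_def)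
  note U = disjoint_pairs_conj[OF P g] P
  show ?plain
  proof
    fix Q assume "Q \<in> orbit ((B3 \<times>\<times> B3) \<times>\<times> AutoGroup G) (\<lambda>a. restrict (hurwitz_act G a) U)
      (conj_triple G g1 T1, conj_triple G g2 T2)"
    then obtain a1 a2 f where a: "a1 \<in> carrier B3" "a2 \<in> carrier B3" "f \<in> carrier (AutoGroup G)"
      and Q: "Q = hurwitz_act G ((a1, a2), f) (conj_triple G g1 T1, conj_triple G g2 T2)"
      using U by (auto simp: orbit_def U_def)
    obtain b1 b2 where b: "b1 \<in> carrier B3" "b2 \<in> carrier B3"
      "Q = hurwitz_act G ((b1, b2), f) (T1, T2)"
      using hurwitz_act_conj[OF T g a(1,2)] Q by metis
    show "Q \<in> orbit ((B3 \<times>\<times> B3) \<times>\<times> AutoGroup G) (\<lambda>a. restrict (hurwitz_act G a) U) (T1, T2)"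
      unfolding orbit_def using U a(3) b
      by (intro CollectI exI[of _ "((b1, b2), f)"]) (auto simp: U_def)
  qed
  show ?swap
  proof
    fix Q assume "Q \<in> orbit (wreath2 B3 \<times>\<times> AutoGroup G) (\<lambda>a. restrict (hurwitz_act_swap G a) U)
      (conj_triple G g1 T1, conj_triple G g2 T2)"
    then obtain a1 a2 e f where a: "a1 \<in> carrier B3" "a2 \<in> carrier B3" "f \<in> carrier (AutoGroup G)"
      and e: "e \<in> carrier (integer_mod_group 2)"
      and Q: "Q = hurwitz_act_swap G (((a1, a2), e), f) (conj_triple G g1 T1, conj_triple G g2 T2)"
      using U by (auto simp: orbit_def U_def wreath2_def)
    obtain b1 b2 where b: "b1 \<in> carrier B3" "b2 \<in> carrier B3"
      "Q = hurwitz_act_swap G (((b1, b2), e), f) (T1, T2)"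
    proof (cases "e = 0")
      case True
      then show ?thesis
        using that hurwitz_act_conj[OF T g a(1,2)] Q by (auto simp: hurwitz_act_swap_def) metis
    next
      case False
      then show ?thesis
        using that hurwitz_act_conj[OF T(2,1) g(2,1) a(1,2)] Q by (auto simp: hurwitz_act_swap_def) metis
    qed
    show "Q \<in> orbit (wreath2 B3 \<times>\<times> AutoGroup G) (\<lambda>a. restrict (hurwitz_act_swap G a) U) (T1, T2)"
      unfolding orbit_def using U a(3) b e
      by (intro CollectI exI[of _ "(((b1, b2), e), f)"]) (auto simp: U_def wreath2_def)
  qed
qed

text \<open>In the application \<open>F\<close> sends a pair of systems to its Hurwitz orbit.  An inclusion for all
conjugations is enough, since conjugating back yields the converse.  The count comes from sending
\<open>(Q, g1, g2)\<close> to the representative of \<open>Q\<close> conjugated by \<open>g1\<close> and \<open>g2\<close>: invariance of \<open>F\<close>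
recovers \<open>Q\<close>, and freeness then recovers \<open>g1\<close> and \<open>g2\<close>.\<close>

lemma card_image_conj_invariant_le:
  assumes fin: "finite (carrier G)"
    and centre: "\<And>z. z \<in> carrier G \<Longrightarrow> (\<And>x. x \<in> carrier G \<Longrightarrow> z \<otimes> x = x \<otimes> z) \<Longrightarrow> z = \<one>"
    and sub: "\<And>T1 T2 g1 g2. (T1, T2) \<in> disjoint_pairs G \<tau>1 \<tau>2 \<Longrightarrow> g1 \<in> carrier G \<Longrightarrow> g2 \<in> carrier G \<Longrightarrow>
       F (conj_triple G g1 T1, conj_triple G g2 T2) \<subseteq> F (T1, T2)"
  shows "card (F ` disjoint_pairs G \<tau>1 \<tau>2) * Coset.order G ^ 2
     \<le> card (systems_of_type G \<tau>1) * card (systems_of_type G \<tau>2)"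
proof -
  let ?U = "disjoint_pairs G \<tau>1 \<tau>2"
  have inv: "F (conj_triple G g1 T1, conj_triple G g2 T2) = F (T1, T2)"
    if "(T1, T2) \<in> ?U" "g1 \<in> carrier G" "g2 \<in> carrier G" for T1 T2 g1 g2
  proof (rule antisym)
    have C: "T1 \<in> carrier G \<times> carrier G \<times> carrier G" "T2 \<in> carrier G \<times> carrier G \<times> carrier G"
      using that spherical_system_carrier by (auto simp: disjoint_pairs_def)
    have "F (conj_triple G (inv g1) (conj_triple G g1 T1), conj_triple G (inv g2) (conj_triple G g2 T2))
      \<subseteq> F (conj_triple G g1 T1, conj_triple G g2 T2)"
      by (rule sub[OF disjoint_pairs_conj[OF that]]) (use that in auto)
    then show "F (T1, T2) \<subseteq> F (conj_triple G g1 T1, conj_triple G g2 T2)"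
      using C that by (simp add: conj_triple_one flip: conj_triple_mult)
  qed (rule sub[OF that])
  define rep where "rep = inv_into ?U F"
  have rep: "rep Q \<in> ?U" "F (rep Q) = Q" if "Q \<in> F ` ?U" for Q
    using that by (auto simp: rep_def inv_into_into f_inv_into_f)
  define \<Phi> where "\<Phi> = (\<lambda>(Q, g1, g2). (conj_triple G g1 (fst (rep Q)), conj_triple G g2 (snd (rep Q))))"
  let ?D = "F ` ?U \<times> carrier G \<times> carrier G"
  have "inj_on \<Phi> ?D"
  proof (rule inj_onI)
    fix u v assume u: "u \<in> ?D" and v: "v \<in> ?D" and uv: "\<Phi> u = \<Phi> v"
    obtain P g1 g2 where P: "P \<in> F ` ?U" and g: "g1 \<in> carrier G" "g2 \<in> carrier G"
      and u': "u = (P, g1, g2)" using u by auto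
    obtain Q h1 h2 where Q: "Q \<in> F ` ?U" and h: "h1 \<in> carrier G" "h2 \<in> carrier G"
      and v': "v = (Q, h1, h2)" using v by auto
    have eq: "\<Phi> (P, g1, g2) = \<Phi> (Q, h1, h2)" using uv u' v' by simp
    define A where "A = rep P"
    define B where "B = rep Q"
    have A: "A \<in> ?U" "F A = P" and B: "B \<in> ?U" "F B = Q"
      using P Q rep by (auto simp: A_def B_def)
    have e: "conj_triple G g1 (fst A) = conj_triple G h1 (fst B)"
      "conj_triple G g2 (snd A) = conj_triple G h2 (snd B)"
      using eq by (simp_all add: \<Phi>_def A_def B_def)
    have "F A = F B"
      using inv[of "fst A" "snd A" g1 g2] inv[of "fst B" "snd B" h1 h2] A B g h by (simp add: e)
    then have FF: "P = Q" using A B by simp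
    then have AB: "B = A" by (simp add: A_def B_def)
    have "spherical_system G (fst A)" "spherical_system G (snd A)"
      using A by (auto simp: disjoint_pairs_def)
    then have "g1 = h1" "g2 = h2"
      using conj_triple_inj centre e g h unfolding AB by blast+
    with FF show "u = v" by (simp add: u' v')
  qed
  moreover have "\<Phi> ` ?D \<subseteq> systems_of_type G \<tau>1 \<times> systems_of_type G \<tau>2"
  proof clarify
    fix T1 T2 g1 g2 S1 S2 assume TU: "(T1, T2) \<in> ?U" and g: "g1 \<in> carrier G" "g2 \<in> carrier G"
      and eq: "(S1, S2) = \<Phi> (F (T1, T2), g1, g2)"
    have "(S1, S2) \<in> ?U"
      using disjoint_pairs_conj[of "fst (rep (F (T1, T2)))" "snd (rep (F (T1, T2)))"] TU g eq
      by (simp add: \<Phi>_def rep)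
    then show "S1 \<in> systems_of_type G \<tau>1 \<and> S2 \<in> systems_of_type G \<tau>2"
      by (auto simp: disjoint_pairs_def systems_of_type_def)
  qed
  moreover have "finite (systems_of_type G \<tau>)" for \<tau>
    by (rule finite_subset[of _ "carrier G \<times> carrier G \<times> carrier G"])
      (use fin spherical_system_carrier in \<open>auto simp: systems_of_type_def\<close>)
  ultimately have "card ?D \<le> card (systems_of_type G \<tau>1 \<times> systems_of_type G \<tau>2)"
    by (intro card_inj_on_le) auto
  then show ?thesis by (simp add: card_cartesian_product Coset.order_def power2_eq_square)
qed

theorem num_beauville_le:
  assumes fin: "finite (carrier G)"
    and centre: "\<And>z. z \<in> carrier G \<Longrightarrow> (\<And>x. x \<in> carrier G \<Longrightarrow> z \<otimes> x = x \<otimes> z) \<Longrightarrow> z = \<one>"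
  shows "num_beauville G \<tau>1 \<tau>2 * Coset.order G ^ 2
     \<le> card (systems_of_type G \<tau>1) * card (systems_of_type G \<tau>2)"
proof -
  have orbits: "orbits H U \<phi> = orbit H \<phi> ` U" for H :: "('x, 'y) monoid_scheme" and U and \<phi> :: "'x \<Rightarrow> 'z \<Rightarrow> 'z"
    by (auto simp: orbits_def)
  let ?U = "disjoint_pairs G \<tau>1 \<tau>2"
  have "card (orbit ((B3 \<times>\<times> B3) \<times>\<times> AutoGroup G) (\<lambda>a. restrict (hurwitz_act G a) ?U) ` ?U) * Coset.order G ^ 2
      \<le> card (systems_of_type G \<tau>1) * card (systems_of_type G \<tau>2)"
    using centre conj_orbit_subset(1) by (intro card_image_conj_invariant_le[OF fin]) blast+
  moreover have "card (orbit (wreath2 B3 \<times>\<times> AutoGroup G) (\<lambda>a. restrict (hurwitz_act_swap G a) ?U) ` ?U) * Coset.order G ^ 2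
      \<le> card (systems_of_type G \<tau>1) * card (systems_of_type G \<tau>2)"
    using centre conj_orbit_subset(2) by (intro card_image_conj_invariant_le[OF fin]) blast+
  ultimately show ?thesis
    by (simp add: num_beauville_def orbits Let_def)
qed

end

section \<open>Polynomials modulo a prime, and matrices over a prime field\<close>

text \<open>Induction on the degree: \<open>f = (X - a) q + f(a)\<close> with \<open>q\<close> monic, so if \<open>a\<close> is a root modulo \<open>p\<close> every
other root modulo \<open>p\<close> is one of \<open>q\<close>.\<close>

lemma card_roots_mod_prime_le:
  fixes p :: int and f :: "int poly"
  assumes p: "prime p" and f: "lead_coeff f = 1"
  shows "card {x \<in> {0..p - 1}. p dvd poly f x} \<le> degree f"
  using f
proof (induction "degree f" arbitrary: f)
  case 0
  then have "f = [:1:]" by (metis degree_eq_zeroE coeff_pCons_0)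
  then show ?case using p by (auto simp: not_prime_unit)
next
  case (Suc n)
  show ?case
  proof (cases "\<exists>a \<in> {0..p - 1}. p dvd poly f a")
    case False
    then have "{x \<in> {0..p - 1}. p dvd poly f x} = {}" by blast
    then show ?thesis by (metis card.empty le0)
  next
    case True
    then obtain a where a: "a \<in> {0..p - 1}" "p dvd poly f a" by blast
    let ?q = "synthetic_div f a"
    have deg: "degree ?q = n" using Suc by (simp add: degree_synthetic_div)
    have "coeff f (Suc n) = 1" using Suc(2,3) by simp
    moreover have "coeff ?q (Suc n) = 0" using deg by (simp add: coeff_eq_0)
    moreover have "coeff f (Suc n) + a * coeff ?q (Suc n) = coeff ?q n"
      using arg_cong[OF synthetic_div_correct[of f a], of "\<lambda>g. coeff g (Suc n)"] by simp
    ultimately have "lead_coeff ?q = 1" using deg by simp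
    then have IH: "card {x \<in> {0..p - 1}. p dvd poly ?q x} \<le> n" using Suc(1)[of ?q] deg by simp
    have "{x \<in> {0..p - 1}. p dvd poly f x} \<subseteq> insert a {x \<in> {0..p - 1}. p dvd poly ?q x}"
    proof
      fix x assume "x \<in> {x \<in> {0..p - 1}. p dvd poly f x}"
      then have x: "x \<in> {0..p - 1}" "p dvd poly f x" by auto
      have "poly f x = (x - a) * poly ?q x + poly f a"
        using arg_cong[OF synthetic_div_correct'[of a f], of "\<lambda>g. poly g x"]
        by (simp add: algebra_simps)
      then have "p dvd (x - a) * poly ?q x" using x a by (simp add: dvd_add_left_iff)
      then have "[x = a] (mod p) \<or> p dvd poly ?q x"
        using p by (simp add: prime_dvd_mult_iff cong_iff_dvd_diff)
      then show "x \<in> insert a {x \<in> {0..p - 1}. p dvd poly ?q x}"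
        using x a by (auto simp: cong_def)
    qed
    then have "card {x \<in> {0..p - 1}. p dvd poly f x} \<le> card (insert a {x \<in> {0..p - 1}. p dvd poly ?q x})"
      by (intro card_mono finite.insertI) (auto intro: finite_subset[of _ "{0..p - 1}"])
    also have "\<dots> \<le> Suc (card {x \<in> {0..p - 1}. p dvd poly ?q x})" by (rule card_insert_le_m1) auto
    finally show ?thesis using IH Suc by simp
  qed
qed

text \<open>Chebyshev polynomials with \<open>S_m(2 cos x) = sin (m x) / sin x\<close>.  The index is the exponent of the
matrix power in which the polynomial appears, so the degree is one less.\<close>

fun chebyshev_S :: "nat \<Rightarrow> int poly" where
  "chebyshev_S 0 = 0"
| "chebyshev_S (Suc 0) = 1"
| "chebyshev_S (Suc (Suc n)) = [:0, 1:] * chebyshev_S (Suc n) - chebyshev_S n"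

lemma chebyshev_S_monic:
  "degree (chebyshev_S (Suc n)) = n \<and> lead_coeff (chebyshev_S (Suc n)) = 1"
proof (induction n rule: less_induct)
  case (less n)
  show ?case
  proof (cases n)
    case (Suc k)
    let ?f = "chebyshev_S (Suc k)"
    have f: "degree ?f = k" "lead_coeff ?f = 1" using less[of k] Suc by auto
    have small: "degree (chebyshev_S k) < Suc k"
      using less[of "k - 1"] Suc by (cases k) auto
    have eq: "chebyshev_S (Suc n) = pCons 0 ?f - chebyshev_S k" by (simp add: Suc)
    have nz: "?f \<noteq> 0" using f by auto
    have c: "coeff (chebyshev_S (Suc n)) (Suc k) = 1" using f small unfolding eq by (simp add: coeff_eq_0)
    have "degree (chebyshev_S (Suc n)) \<le> Suc k" unfolding eq
      using f small nz by (intro degree_diff_le) auto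
    moreover have "degree (chebyshev_S (Suc n)) \<ge> Suc k" using c by (intro le_degree) simp
    ultimately show ?thesis using c Suc by simp
  qed simp
qed

context residues_prime
begin

lemma p_pos: "p > 0" "int p > 1" using p_prime prime_gt_0_nat m_gt_one by auto

lemma prime_int_p: "prime (int p)" using p_prime by simp

lemma mod_range [simp]: "0 \<le> x mod int p" "x mod int p < int p"
  using p_pos by auto

lemma mod_bilinear:
  "(x * (u mod m) + y * (v mod m)) mod m = (x * u + y * v) mod m"
  "((u mod m) * x + (v mod m) * y) mod m = (u * x + v * y) mod m" for x y u v m :: int
  by (rule mod_add_cong; simp add: mod_simps)+

lemma SL2_carrier_iff:
  "(a, b, c, d) \<in> carrier (SL2 R) \<longleftrightarrow>
    a \<in> {0..int p - 1} \<and> b \<in> {0..int p - 1} \<and> c \<in> {0..int p - 1} \<and> d \<in> {0..int p - 1} \<and>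
    [a * d - b * c = 1] (mod int p)"
proof -
  have "a \<otimes> d \<ominus> b \<otimes> c = (a * d - b * c) mod int p"
    by (simp add: a_minus_def res_add_eq res_mult_eq res_neg_eq mod_simps)
  then show ?thesis
    using p_pos by (simp add: SL2_def res_carrier_eq res_one_eq cong_def)
qed

lemma SL2_mult:
  "(a, b, c, d) \<otimes>\<^bsub>SL2 R\<^esub> (a', b', c', d') =
    ((a * a' + b * c') mod int p, (a * b' + b * d') mod int p,
     (c * a' + d * c') mod int p, (c * b' + d * d') mod int p)"
  by (simp add: SL2_def res_add_eq res_mult_eq mod_simps)

lemma SL2_one: "\<one>\<^bsub>SL2 R\<^esub> = (1, 0, 0, 1)"
  by (simp add: SL2_def res_one_eq res_zero_eq)

lemma SL2_inverse:
  assumes "(a, b, c, d) \<in> carrier (SL2 R)"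
  shows "(d, - b mod int p, - c mod int p, a) \<in> carrier (SL2 R)"
    and "(d, - b mod int p, - c mod int p, a) \<otimes>\<^bsub>SL2 R\<^esub> (a, b, c, d) = \<one>\<^bsub>SL2 R\<^esub>"
proof -
  have det: "[a * d - b * c = 1] (mod int p)" using assms by (simp add: SL2_carrier_iff)
  have "[d * a - (- b mod int p) * (- c mod int p) = d * a - (- b) * (- c)] (mod int p)"
    by (intro cong_diff cong_mult cong_refl) simp_all
  then have "[d * a - (- b mod int p) * (- c mod int p) = 1] (mod int p)"
    using cong_trans det by (simp add: mult.commute)
  then show "(d, - b mod int p, - c mod int p, a) \<in> carrier (SL2 R)"
    using assms by (simp add: SL2_carrier_iff)
  have red: "(d * x + (- b mod int p) * y) mod int p = (d * x + (- b) * y) mod int p"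
    "((- c mod int p) * x + a * y) mod int p = ((- c) * x + a * y) mod int p" for x y
    by (metis mod_add_left_eq mod_add_right_eq mod_mult_left_eq)+
  then show "(d, - b mod int p, - c mod int p, a) \<otimes>\<^bsub>SL2 R\<^esub> (a, b, c, d) = \<one>\<^bsub>SL2 R\<^esub>"
    using det p_pos unfolding SL2_mult SL2_one red by (simp add: cong_def algebra_simps)
qed

lemma group_SL2: "group (SL2 R)"
proof (rule groupI)
  show "x \<otimes>\<^bsub>SL2 R\<^esub> y \<in> carrier (SL2 R)" if "x \<in> carrier (SL2 R)" "y \<in> carrier (SL2 R)" for x y
  proof -
    obtain a b c d a' b' c' d' where [simp]: "x = (a, b, c, d)" "y = (a', b', c', d')"
      by (cases x, cases y) auto
    have "[(a * d - b * c) * (a' * d' - b' * c') = 1 * 1] (mod int p)"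
      using that by (intro cong_mult) (simp_all add: SL2_carrier_iff)
    then have det: "[(a * a' + b * c') * (c * b' + d * d') - (a * b' + b * d') * (c * a' + d * c') = 1] (mod int p)"
      by (simp add: algebra_simps)
    have "[(a * a' + b * c') mod int p * ((c * b' + d * d') mod int p) -
        (a * b' + b * d') mod int p * ((c * a' + d * c') mod int p) = 1] (mod int p)"
      by (rule cong_trans[OF _ det]) (intro cong_diff cong_mult; simp)
    then show ?thesis by (simp add: SL2_carrier_iff SL2_mult)
  qed
  show "\<one>\<^bsub>SL2 R\<^esub> \<in> carrier (SL2 R)" using p_pos by (simp add: SL2_one SL2_carrier_iff)
  show "x \<otimes>\<^bsub>SL2 R\<^esub> y \<otimes>\<^bsub>SL2 R\<^esub> z = x \<otimes>\<^bsub>SL2 R\<^esub> (y \<otimes>\<^bsub>SL2 R\<^esub> z)" for x y z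
    by (cases x, cases y, cases z) (simp add: SL2_mult mod_bilinear; simp add: algebra_simps)
  show "\<one>\<^bsub>SL2 R\<^esub> \<otimes>\<^bsub>SL2 R\<^esub> x = x" if "x \<in> carrier (SL2 R)" for x
    using that by (cases x) (simp add: SL2_mult SL2_one SL2_carrier_iff)
  show "\<exists>y\<in>carrier (SL2 R). y \<otimes>\<^bsub>SL2 R\<^esub> x = \<one>\<^bsub>SL2 R\<^esub>" if "x \<in> carrier (SL2 R)" for x
    using that SL2_inverse by (cases x) blast
qed

definition pm_one :: "(int \<times> int \<times> int \<times> int) set" where
  "pm_one = {(1, 0, 0, 1), (- 1 mod int p, 0, 0, - 1 mod int p)}"

lemma PSL2_eq: "PSL2 R = SL2 R Mod pm_one"
  by (simp add: PSL2_def pm_one_def res_one_eq res_zero_eq res_neg_eq)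

lemma pm_one_subset: "pm_one \<subseteq> carrier (SL2 R)"
  using p_pos by (auto simp: pm_one_def SL2_carrier_iff) (simp add: cong_def mod_simps)

lemma pm_one_mult:
  "(1, 0, 0, 1) \<otimes>\<^bsub>SL2 R\<^esub> (a, b, c, d) = (a mod int p, b mod int p, c mod int p, d mod int p)"
  "(a, b, c, d) \<otimes>\<^bsub>SL2 R\<^esub> (1, 0, 0, 1) = (a mod int p, b mod int p, c mod int p, d mod int p)"
  "(- 1 mod int p, 0, 0, - 1 mod int p) \<otimes>\<^bsub>SL2 R\<^esub> (a, b, c, d) =
    (- a mod int p, - b mod int p, - c mod int p, - d mod int p)"
  "(a, b, c, d) \<otimes>\<^bsub>SL2 R\<^esub> (- 1 mod int p, 0, 0, - 1 mod int p) =
    (- a mod int p, - b mod int p, - c mod int p, - d mod int p)"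
  by (simp_all add: SL2_mult mod_simps)

lemma pm_one_commutes: "z \<in> pm_one \<Longrightarrow> z \<otimes>\<^bsub>SL2 R\<^esub> A = A \<otimes>\<^bsub>SL2 R\<^esub> z"
  by (cases A) (auto simp: pm_one_def pm_one_mult simp del: mod_minus_eq)

lemma normal_pm_one: "pm_one \<lhd> SL2 R"
proof -
  interpret S: group "SL2 R" by (rule group_SL2)
  have inv: "z \<otimes>\<^bsub>SL2 R\<^esub> z = \<one>\<^bsub>SL2 R\<^esub>" if "z \<in> pm_one" for z
    using that p_pos by (auto simp: pm_one_def SL2_mult SL2_one mod_simps)
  have "subgroup pm_one (SL2 R)"
  proof (rule S.subgroupI[OF pm_one_subset])
    show "pm_one \<noteq> {}" by (simp add: pm_one_def)
    show "inv\<^bsub>SL2 R\<^esub> a \<in> pm_one" if "a \<in> pm_one" for a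
    proof -
      have "a \<in> carrier (SL2 R)" using that pm_one_subset by blast
      then have "inv\<^bsub>SL2 R\<^esub> a = a" using S.inv_equality[OF inv[OF that]] by blast
      then show ?thesis using that by simp
    qed
    show "a \<otimes>\<^bsub>SL2 R\<^esub> b \<in> pm_one" if "a \<in> pm_one" "b \<in> pm_one" for a b
      using that p_pos unfolding pm_one_def by (auto simp: SL2_mult mod_simps)
  qed
  then show ?thesis
  proof (rule S.normal_invI)
    fix A z assume A: "A \<in> carrier (SL2 R)" "z \<in> pm_one"
    then have "z \<in> carrier (SL2 R)" using pm_one_subset by blast
    then have "A \<otimes>\<^bsub>SL2 R\<^esub> z \<otimes>\<^bsub>SL2 R\<^esub> inv\<^bsub>SL2 R\<^esub> A = z"
      using A(1) by (simp flip: pm_one_commutes[OF A(2)] add: S.m_assoc)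
    with A show "A \<otimes>\<^bsub>SL2 R\<^esub> z \<otimes>\<^bsub>SL2 R\<^esub> inv\<^bsub>SL2 R\<^esub> A \<in> pm_one" by simp
  qed
qed

sublocale PSL: normal pm_one "SL2 R" by (rule normal_pm_one)

lemma group_PSL2: "group (PSL2 R)"
  unfolding PSL2_eq by (rule PSL.factorgroup_is_group)

lemma finite_SL2: "finite (carrier (SL2 R))"
  by (rule finite_subset[of _ "{0..int p - 1} \<times> {0..int p - 1} \<times> {0..int p - 1} \<times> {0..int p - 1}"])
    (auto simp: SL2_carrier_iff)

lemma finite_PSL2: "finite (carrier (PSL2 R))"
  using finite_SL2 by (simp add: PSL2_eq carrier_FactGroup)

lemma PSL2_carrierE:
  assumes "x \<in> carrier (PSL2 R)"
  obtains A where "A \<in> carrier (SL2 R)" "x = pm_one #>\<^bsub>SL2 R\<^esub> A"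
  using assms by (auto simp: PSL2_eq carrier_FactGroup)

lemma coset_eq_iff:
  assumes "A \<in> carrier (SL2 R)" "B \<in> carrier (SL2 R)"
  shows "pm_one #>\<^bsub>SL2 R\<^esub> A = pm_one #>\<^bsub>SL2 R\<^esub> B \<longleftrightarrow> (\<exists>z\<in>pm_one. A = z \<otimes>\<^bsub>SL2 R\<^esub> B)"
proof -
  have "pm_one #>\<^bsub>SL2 R\<^esub> A = pm_one #>\<^bsub>SL2 R\<^esub> B \<longleftrightarrow> A \<in> pm_one #>\<^bsub>SL2 R\<^esub> B"
    using assms PSL.repr_independence PSL.rcos_self PSL.subgroup_axioms by metis
  then show ?thesis by (auto simp: r_coset_def)
qed

lemma coset_eq_one_iff:
  assumes "A \<in> carrier (SL2 R)"
  shows "pm_one #>\<^bsub>SL2 R\<^esub> A = \<one>\<^bsub>PSL2 R\<^esub> \<longleftrightarrow> A \<in> pm_one"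
proof -
  have "\<one>\<^bsub>PSL2 R\<^esub> = pm_one #>\<^bsub>SL2 R\<^esub> \<one>\<^bsub>SL2 R\<^esub>"
    by (simp add: PSL2_eq PSL.coset_mult_one PSL.subset)
  then have "pm_one #>\<^bsub>SL2 R\<^esub> A = \<one>\<^bsub>PSL2 R\<^esub> \<longleftrightarrow> (\<exists>z\<in>pm_one. A = z \<otimes>\<^bsub>SL2 R\<^esub> \<one>\<^bsub>SL2 R\<^esub>)"
    using assms by (simp only: coset_eq_iff PSL.one_closed)
  also have "\<dots> \<longleftrightarrow> A \<in> pm_one" using pm_one_subset by (auto simp: subset_iff)
  finally show ?thesis .
qed

text \<open>If \<open>a\<close> is invertible, \<open>b\<close> and \<open>c\<close> can be chosen freely and determine \<open>d\<close>.\<close>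

lemma card_SL2_ge: "(p - 1) * p ^ 2 \<le> card (carrier (SL2 R))"
proof -
  let ?V = "{0..int p - 1}"
  let ?D = "{1..int p - 1} \<times> ?V \<times> ?V"
  have "?D \<subseteq> (\<lambda>(a, b, c, d). (a, b, c)) ` carrier (SL2 R)"
  proof clarify
    fix a b c assume a: "a \<in> {1..int p - 1}" and bc: "b \<in> ?V" "c \<in> ?V"
    have "\<not> int p dvd a" using a zdvd_not_zless by auto
    then have "coprime a (int p)" using p_coprime_right_int by blast
    then obtain i where i: "[a * i = 1] (mod int p)" using cong_solve_coprime_int by blast
    let ?d = "(i * (1 + b * c)) mod int p"
    have "[(a * i) * (1 + b * c) - b * c = 1 * (1 + b * c) - b * c] (mod int p)"
      by (intro cong_diff cong_mult i cong_refl)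
    then have det: "[a * (i * (1 + b * c)) - b * c = 1] (mod int p)" by (simp add: mult.assoc)
    have "[a * ?d - b * c = 1] (mod int p)"
      by (rule cong_trans[OF _ det]) (intro cong_diff cong_mult cong_refl; simp)
    then have "(a, b, c, ?d) \<in> carrier (SL2 R)" using a bc by (simp add: SL2_carrier_iff)
    then show "(a, b, c) \<in> (\<lambda>(a, b, c, d). (a, b, c)) ` carrier (SL2 R)" by force
  qed
  then have "card ?D \<le> card (carrier (SL2 R))" by (rule surj_card_le[OF finite_SL2])
  moreover have "nat (int p - 1) = p - 1" by simp
  ultimately show ?thesis by (simp add: card_cartesian_product power2_eq_square)
qed

lemma order_PSL2_ge:
  assumes "odd p"
  shows "p ^ 3 \<le> 3 * Coset.order (PSL2 R)"
proof -
  have "carrier (SL2 R) \<subseteq> \<Union> (carrier (PSL2 R))"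
    using PSL.rcos_self PSL.subgroup_axioms by (auto simp: PSL2_eq carrier_FactGroup)
  moreover have fin: "finite Q" "card Q \<le> 2" if Q: "Q \<in> carrier (PSL2 R)" for Q
  proof -
    obtain A where "Q = pm_one #>\<^bsub>SL2 R\<^esub> A" using Q by (rule PSL2_carrierE)
    then have "Q = {(1, 0, 0, 1) \<otimes>\<^bsub>SL2 R\<^esub> A, (- 1 mod int p, 0, 0, - 1 mod int p) \<otimes>\<^bsub>SL2 R\<^esub> A}"
      by (auto simp: r_coset_def pm_one_def)
    then show "finite Q" "card Q \<le> 2" by (auto simp: card_insert_if)
  qed
  ultimately have "card (carrier (SL2 R)) \<le> card (\<Union> (carrier (PSL2 R)))"
    using finite_PSL2 by (intro card_mono) auto
  also have "\<dots> \<le> (\<Sum>Q\<in>carrier (PSL2 R). card Q)"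
    by (rule card_Union_le_sum_card)
  also have "\<dots> \<le> Coset.order (PSL2 R) * 2"
    using sum_bounded_above[of "carrier (PSL2 R)" card 2] fin by (simp add: Coset.order_def)
  finally have "(p - 1) * p ^ 2 \<le> 2 * Coset.order (PSL2 R)" using card_SL2_ge by simp
  moreover have "2 * p \<le> 3 * (p - 1)"
  proof -
    have "p \<noteq> 2" using assms by auto
    then have "p \<ge> 3" using p_prime prime_ge_2_nat[of p] by simp
    then show ?thesis by simp
  qed
  then have "2 * p * p ^ 2 \<le> 3 * (p - 1) * p ^ 2" by (rule mult_le_mono1)
  ultimately have "2 * p * p ^ 2 \<le> 3 * (2 * Coset.order (PSL2 R))" by (simp only: mult.assoc)
  then show ?thesis by (simp add: power3_eq_cube power2_eq_square)
qed

text \<open>A matrix representing a central element commutes up to sign with the two elementary unipotent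
matrices.  The sign is \<open>+\<close>, because conjugate matrices have equal traces and \<open>2 \<noteq> - 2\<close> for odd
\<open>p\<close>; commuting with both unipotents makes the matrix scalar.  Below, the negative sign is excluded by
looking at entries.\<close>

lemma PSL2_centre_trivial:
  assumes odd: "odd p" and z: "z \<in> carrier (PSL2 R)"
    and comm: "\<And>x. x \<in> carrier (PSL2 R) \<Longrightarrow> z \<otimes>\<^bsub>PSL2 R\<^esub> x = x \<otimes>\<^bsub>PSL2 R\<^esub> z"
  shows "z = \<one>\<^bsub>PSL2 R\<^esub>"
proof -
  have cancel2: "int p dvd x" if "int p dvd 2 * x" for x
  proof -
    have "\<not> int p dvd 2"
    proof
      assume "int p dvd 2"
      then have "int p \<le> 2" by (rule zdvd_imp_le) simp
      then have "p = 2" using p_pos by linarith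
      then show False using odd by simp
    qed
    then show ?thesis using that prime_int_p by (simp add: prime_dvd_mult_iff)
  qed
  obtain A where A: "A \<in> carrier (SL2 R)" and zA: "z = pm_one #>\<^bsub>SL2 R\<^esub> A" using z by (rule PSL2_carrierE)
  obtain a b c d where A': "A = (a, b, c, d)" by (cases A) auto
  have r: "a \<in> {0..int p - 1}" "b \<in> {0..int p - 1}" "c \<in> {0..int p - 1}" "d \<in> {0..int p - 1}"
    and det: "[a * d - b * c = 1] (mod int p)" using A by (auto simp: A' SL2_carrier_iff)
  have zero: "x = 0" if "int p dvd x" "x \<in> {0..int p - 1}" for x
    using that by (simp add: dvd_eq_mod_eq_0)
  have up_to_sign: "A \<otimes>\<^bsub>SL2 R\<^esub> H = H \<otimes>\<^bsub>SL2 R\<^esub> A \<or>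
      A \<otimes>\<^bsub>SL2 R\<^esub> H = (- 1 mod int p, 0, 0, - 1 mod int p) \<otimes>\<^bsub>SL2 R\<^esub> (H \<otimes>\<^bsub>SL2 R\<^esub> A)"
    if H: "H \<in> carrier (SL2 R)" for H
  proof -
    have "pm_one #>\<^bsub>SL2 R\<^esub> H \<in> carrier (PSL2 R)" using H by (auto simp: PSL2_eq carrier_FactGroup)
    from comm[OF this] have "pm_one #>\<^bsub>SL2 R\<^esub> (A \<otimes>\<^bsub>SL2 R\<^esub> H) = pm_one #>\<^bsub>SL2 R\<^esub> (H \<otimes>\<^bsub>SL2 R\<^esub> A)"
      using A H by (simp add: PSL2_eq zA PSL.rcos_sum)
    then obtain y where y: "y \<in> pm_one" "A \<otimes>\<^bsub>SL2 R\<^esub> H = y \<otimes>\<^bsub>SL2 R\<^esub> (H \<otimes>\<^bsub>SL2 R\<^esub> A)"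
      using A H by (auto simp: coset_eq_iff)
    have "(1, 0, 0, 1) \<otimes>\<^bsub>SL2 R\<^esub> (H \<otimes>\<^bsub>SL2 R\<^esub> A) = H \<otimes>\<^bsub>SL2 R\<^esub> A"
      using A H by (simp flip: SL2_one)
    with y show ?thesis by (auto simp: pm_one_def)
  qed
  have upper: "c = 0 \<and> a = d"
  proof -
    have "(1, 1, 0, 1) \<in> carrier (SL2 R)" using p_pos by (simp add: SL2_carrier_iff)
    from up_to_sign[OF this] show ?thesis
    proof
      assume "A \<otimes>\<^bsub>SL2 R\<^esub> (1, 1, 0, 1) = (1, 1, 0, 1) \<otimes>\<^bsub>SL2 R\<^esub> A"
      then have "[a = a + c] (mod int p)" "[a + b = b + d] (mod int p)"
        by (simp_all add: A' SL2_mult cong_def)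
      then have "int p dvd c" "[a = d] (mod int p)"
        by (simp_all add: cong_iff_dvd_diff algebra_simps)
      then show ?thesis using r zero[of c] by (simp add: cong_def)
    next
      assume "A \<otimes>\<^bsub>SL2 R\<^esub> (1, 1, 0, 1) =
        (- 1 mod int p, 0, 0, - 1 mod int p) \<otimes>\<^bsub>SL2 R\<^esub> ((1, 1, 0, 1) \<otimes>\<^bsub>SL2 R\<^esub> A)"
      then have 1: "[a = - (a + c)] (mod int p)" "[c = - c] (mod int p)"
        by (simp_all add: A' SL2_mult pm_one_mult cong_def mod_simps)
      then have "int p dvd 2 * c" by (simp add: cong_iff_dvd_diff)
      then have c: "c = 0" using cancel2 zero r by blast
      then have "int p dvd 2 * a" using 1 by (simp add: cong_iff_dvd_diff)
      then have "a = 0" using cancel2 zero r by blast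
      then show ?thesis using det c p_pos by (simp add: cong_def)
    qed
  qed
  have lower: "b = 0"
  proof -
    have "(1, 0, 1, 1) \<in> carrier (SL2 R)" using p_pos by (simp add: SL2_carrier_iff)
    from up_to_sign[OF this] show ?thesis
    proof
      assume "A \<otimes>\<^bsub>SL2 R\<^esub> (1, 0, 1, 1) = (1, 0, 1, 1) \<otimes>\<^bsub>SL2 R\<^esub> A"
      then have "[a + b = a] (mod int p)" by (simp add: A' SL2_mult cong_def)
      then show ?thesis using r zero[of b] by (simp add: cong_iff_dvd_diff)
    next
      assume "A \<otimes>\<^bsub>SL2 R\<^esub> (1, 0, 1, 1) =
        (- 1 mod int p, 0, 0, - 1 mod int p) \<otimes>\<^bsub>SL2 R\<^esub> ((1, 0, 1, 1) \<otimes>\<^bsub>SL2 R\<^esub> A)"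
      then have "[b = - b] (mod int p)"
        by (simp add: A' SL2_mult pm_one_mult cong_def mod_simps)
      then have "int p dvd 2 * b" by (simp add: cong_iff_dvd_diff)
      then show ?thesis using cancel2 zero r by blast
    qed
  qed
  have "[a * a = 1] (mod int p)" using det upper lower by simp
  then have "int p dvd (a - 1) * (a + 1)" by (simp add: cong_iff_dvd_diff algebra_simps)
  then have "int p dvd a - 1 \<or> int p dvd a + 1" using prime_int_p by (simp add: prime_dvd_mult_iff)
  then have "[a = 1] (mod int p) \<or> [a = - 1] (mod int p)" by (simp add: cong_iff_dvd_diff)
  then have "a = 1 \<or> a = - 1 mod int p" using r p_pos by (simp add: cong_def)
  then have "A \<in> pm_one" using upper lower by (auto simp: A' pm_one_def)
  then show ?thesis using A coset_eq_one_iff zA by simp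
qed

end

section \<open>Counting pairs of matrices with prescribed traces\<close>

lemma card_Sigma_le:
  assumes "finite I" "\<And>i. i \<in> I \<Longrightarrow> finite (B i)" "\<And>i. i \<in> I \<Longrightarrow> card (B i) \<le> k"
  shows "card (Sigma I B) \<le> card I * k"
  using sum_bounded_above[of I "\<lambda>i. card (B i)" k] assms by (simp add: card_SigmaI)

context residues_prime
begin

abbreviation Fp :: "int set" where "Fp \<equiv> {0..int p - 1}"

lemma Fp_cong: "x \<in> Fp \<Longrightarrow> y \<in> Fp \<Longrightarrow> [x = y] (mod int p) \<Longrightarrow> x = y"
  by (simp add: cong_def)

lemma Fp_dvd: "x \<in> Fp \<Longrightarrow> int p dvd x \<Longrightarrow> x = 0"
  by (simp add: dvd_eq_mod_eq_0)

lemma cong_cancel: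
  assumes "\<not> int p dvd g" "[g * x = g * y] (mod int p)"
  shows "[x = y] (mod int p)"
  using assms prime_int_p by (simp add: cong_iff_dvd_diff prime_dvd_mult_iff flip: right_diff_distrib)

lemma card_quadratic_le: "card {x \<in> Fp. int p dvd x ^ 2 + \<beta> * x + \<gamma>} \<le> 2"
  using card_roots_mod_prime_le[OF prime_int_p, of "[:\<gamma>, \<beta>, 1:]"]
  by (simp add: algebra_simps power2_eq_square)

definition trace :: "int \<times> int \<times> int \<times> int \<Rightarrow> int" where
  "trace = (\<lambda>(x, y, z, w). (x + w) mod int p)"

lemma trace_in_Fp: "trace A \<in> Fp"
  by (cases A) (simp add: trace_def)

text \<open>The Cayley-Hamilton theorem \<open>A^2 = (tr A) A - 1\<close>, iterated.\<close>

lemma SL2_pow: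
  assumes A: "(e, f, g, h) \<in> carrier (SL2 R)"
  defines "u \<equiv> \<lambda>n. poly (chebyshev_S n) (e + h)"
  shows "(e, f, g, h) [^]\<^bsub>SL2 R\<^esub> Suc n =
    ((u (Suc n) * e - u n) mod int p, (u (Suc n) * f) mod int p,
     (u (Suc n) * g) mod int p, (u (Suc n) * h - u n) mod int p)"
proof (induction n)
  case 0
  show ?case using A by (simp add: u_def SL2_carrier_iff)
next
  case (Suc n)
  have rec: "u (Suc (Suc n)) = (e + h) * u (Suc n) - u n" by (simp add: u_def)
  have det: "[e * h - f * g = 1] (mod int p)" using A by (simp add: SL2_carrier_iff)
  have "[u (Suc n) * (e * h - f * g) = u (Suc n) * 1] (mod int p)" by (intro cong_mult cong_refl det)
  then have 1: "int p dvd u (Suc n) * (f * g) - (u (Suc n) * (e * h) - u (Suc n))"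
    by (subst dvd_minus_iff[symmetric]) (simp add: cong_iff_dvd_diff algebra_simps)
  have "[(u (Suc n) * e - u n) * e + u (Suc n) * f * g = u (Suc (Suc n)) * e - u (Suc n)] (mod int p)"
    "[u (Suc n) * g * f + (u (Suc n) * h - u n) * h = u (Suc (Suc n)) * h - u (Suc n)] (mod int p)"
    using 1 by (simp_all add: cong_iff_dvd_diff rec algebra_simps)
  moreover have "(u (Suc n) * e - u n) * f + u (Suc n) * f * h = u (Suc (Suc n)) * f"
    "u (Suc n) * g * e + (u (Suc n) * h - u n) * g = u (Suc (Suc n)) * g"
    by (simp_all add: rec algebra_simps)
  ultimately show ?case
    by (simp only: PSL.nat_pow_Suc[of _ "Suc n"] Suc.IH SL2_mult mod_bilinear(2) cong_def)
qed

lemma not_scalar: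
  assumes "(e, f, g, h) \<in> carrier (SL2 R)" "(e, f, g, h) \<notin> pm_one"
  shows "f \<noteq> 0 \<or> g \<noteq> 0 \<or> e \<noteq> h"
proof (rule ccontr)
  assume "\<not> ?thesis"
  then have 0: "f = 0" "g = 0" "h = e" by auto
  then have "[e * e = 1] (mod int p)" using assms by (simp add: SL2_carrier_iff)
  then have "int p dvd (e - 1) * (e + 1)" by (simp add: cong_iff_dvd_diff algebra_simps)
  then have "[e = 1] (mod int p) \<or> [e = - 1] (mod int p)"
    using prime_int_p by (simp add: prime_dvd_mult_iff cong_iff_dvd_diff)
  then have "e = 1 \<or> e = - 1 mod int p" using assms p_pos by (simp add: cong_def SL2_carrier_iff)
  then show False using assms 0 by (auto simp: pm_one_def)
qed

text \<open>A superset of the traces of the matrices whose image in \<open>PSL(2,p)\<close> is non-trivial and killed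
by \<open>m\<close>.\<close>

definition order_traces :: "nat \<Rightarrow> int set" where
  "order_traces m = {t \<in> Fp. int p dvd poly (chebyshev_S m) t}"

lemma card_order_traces_le: "m > 0 \<Longrightarrow> card (order_traces m) \<le> m"
  using card_roots_mod_prime_le[OF prime_int_p, of "chebyshev_S m"] chebyshev_S_monic[of "m - 1"]
  by (auto simp: order_traces_def)

lemma poly_cong_mod: "[poly f x = poly f y] (mod m)" if "[x = y] (mod m)" for f :: "int poly" and x y m :: int
  using that by (induction f) (auto intro!: cong_add cong_mult)

text \<open>\<open>A^m\<close> and the identity are scalar, so \<open>S_m(tr A) A\<close> is scalar; as \<open>A\<close> is not, the coefficient
\<open>S_m(tr A)\<close> vanishes.\<close>

lemma trace_of_finite_order:
  assumes A: "A \<in> carrier (SL2 R)" "A \<notin> pm_one"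
    and m: "m > 0" "(pm_one #>\<^bsub>SL2 R\<^esub> A) [^]\<^bsub>PSL2 R\<^esub> m = \<one>\<^bsub>PSL2 R\<^esub>"
  shows "trace A \<in> order_traces m"
proof -
  obtain e f g h where A': "A = (e, f, g, h)" by (cases A) auto
  obtain n where n: "m = Suc n" using m gr0_implies_Suc by blast
  let ?u = "poly (chebyshev_S m) (e + h)" and ?v = "poly (chebyshev_S n) (e + h)"
  have "pm_one #>\<^bsub>SL2 R\<^esub> (A [^]\<^bsub>SL2 R\<^esub> m) = \<one>\<^bsub>PSL2 R\<^esub>"
    using m A by (simp add: PSL2_eq PSL.FactGroup_pow)
  then have "A [^]\<^bsub>SL2 R\<^esub> m \<in> pm_one" using A by (simp add: coset_eq_one_iff)
  then have "(?u * f) mod int p = 0" "(?u * g) mod int p = 0"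
    "(?u * e - ?v) mod int p = (?u * h - ?v) mod int p"
    using A unfolding A' n SL2_pow[OF A(1)[unfolded A']] by (auto simp: pm_one_def)
  then have "int p dvd ?u * f" "int p dvd ?u * g" "int p dvd ?u * (e - h)"
    by (auto simp: mod_eq_dvd_iff algebra_simps)
  moreover have "\<not> int p dvd f \<or> \<not> int p dvd g \<or> \<not> int p dvd e - h"
  proof -
    have Fp: "e \<in> Fp" "f \<in> Fp" "g \<in> Fp" "h \<in> Fp" using A by (auto simp: A' SL2_carrier_iff)
    show ?thesis using not_scalar[of e f g h] A Fp_dvd[OF Fp(2)] Fp_dvd[OF Fp(3)] Fp_cong[OF Fp(1) Fp(4)]
      by (auto simp: A' cong_iff_dvd_diff)
  qed
  ultimately have "int p dvd ?u" using prime_int_p by (auto simp: prime_dvd_mult_iff)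
  moreover have "[?u = poly (chebyshev_S m) (trace A)] (mod int p)"
    by (rule poly_cong_mod) (simp add: A' trace_def)
  ultimately have "int p dvd poly (chebyshev_S m) (trace A)" by (simp add: cong_dvd_iff)
  then show ?thesis using trace_in_Fp by (simp add: order_traces_def)
qed

text \<open>The off-diagonal entries are arbitrary; given them, the diagonal entries are the two roots of a
quadratic polynomial.\<close>

lemma card_trace_fibre_le: "card {A \<in> carrier (SL2 R). trace A = a} \<le> 2 * p ^ 2"
proof -
  let ?S = "{A \<in> carrier (SL2 R). trace A = a}"
  let ?B = "\<lambda>(y, z). {x \<in> Fp. int p dvd x ^ 2 + (- a) * x + (1 + y * z)}"
  have S: "x \<in> Fp \<and> y \<in> Fp \<and> z \<in> Fp \<and> w \<in> Fp \<and> [x + w = a] (mod int p) \<and> [x * w - y * z = 1] (mod int p)"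
    if "(x, y, z, w) \<in> ?S" for x y z w
    using that by (auto simp: trace_def SL2_carrier_iff cong_def)
  have "card ?S \<le> card (Sigma (Fp \<times> Fp) ?B)"
  proof (rule card_inj_on_le)
    show "inj_on (\<lambda>(x, y, z, w). ((y, z), x)) ?S"
    proof (rule inj_onI)
      fix A B assume AB: "A \<in> ?S" "B \<in> ?S"
        and eq: "(case A of (x, y, z, w) \<Rightarrow> ((y, z), x)) = (case B of (x, y, z, w) \<Rightarrow> ((y, z), x))"
      obtain x y z w where A: "A = (x, y, z, w)" by (cases A) auto
      obtain w' where B: "B = (x, y, z, w')" using eq A by (cases B) auto
      have "[x + w = x + w'] (mod int p)" using AB by (auto simp: A B trace_def cong_def)
      then have "w = w'" using Fp_cong[of w w'] AB by (simp add: A B cong_add_lcancel SL2_carrier_iff)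
      then show "A = B" by (simp add: A B)
    qed
    show "(\<lambda>(x, y, z, w). ((y, z), x)) ` ?S \<subseteq> Sigma (Fp \<times> Fp) ?B"
    proof (rule image_subsetI)
      fix A assume A: "A \<in> ?S"
      obtain x y z w where A': "A = (x, y, z, w)" by (cases A) auto
      note s = S[OF A[unfolded A']]
      have "[x * (x + w) - (x * w - y * z) = x * a - 1] (mod int p)"
        using s by (intro cong_diff cong_mult cong_refl) auto
      then have "int p dvd x ^ 2 + (- a) * x + (1 + y * z)"
        by (simp add: cong_iff_dvd_diff algebra_simps power2_eq_square)
      then show "(case A of (x, y, z, w) \<Rightarrow> ((y, z), x)) \<in> Sigma (Fp \<times> Fp) ?B"
        using s by (simp add: A')
    qed
  qed (auto intro!: finite_SigmaI intro: finite_subset[of _ Fp])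
  also have "\<dots> \<le> card (Fp \<times> Fp) * 2"
    by (rule card_Sigma_le) (use card_quadratic_le[of "- a"] in \<open>auto intro: finite_subset[of _ Fp]\<close>)
  finally show ?thesis by (simp add: card_cartesian_product power2_eq_square)
qed

text \<open>For \<open>A = (e, f, g, h)\<close>, the matrices \<open>B\<close> of determinant \<open>1\<close> with \<open>tr B = b\<close> and
\<open>tr (A B) = c\<close>.\<close>

definition partners :: "int \<times> int \<times> int \<times> int \<Rightarrow> int \<Rightarrow> int \<Rightarrow> (int \<times> int \<times> int \<times> int) set" where
  "partners = (\<lambda>(e, f, g, h) b c. {(x, y, z, w). x \<in> Fp \<and> y \<in> Fp \<and> z \<in> Fp \<and> w \<in> Fp \<and>
     [x + w = b] (mod int p) \<and> [e * x + f * z + (g * y + h * w) = c] (mod int p) \<and>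
     [x * w - y * z = 1] (mod int p)})"

lemma finite_partners: "finite (partners A b c)"
  by (rule finite_subset[of _ "Fp \<times> Fp \<times> Fp \<times> Fp"]) (cases A; auto simp: partners_def)+

text \<open>Here \<open>y\<close> is eliminated with the help of \<open>tr (A B) = c\<close>, and \<open>x\<close> with \<open>tr B = b\<close>.  For fixed \<open>z\<close>
the determinant condition becomes quadratic in \<open>w\<close>, with leading coefficient \<open>-1\<close> whatever the
values of \<open>e, f, g, h\<close>, so it never degenerates.\<close>

lemma card_partners_lower_le:
  assumes g: "\<not> int p dvd g"
  shows "card (partners (e, f, g, h) b c) \<le> 2 * p"
proof -
  have "coprime g (int p)" using g p_coprime_right_int by blast
  then obtain i where i: "[g * i = 1] (mod int p)" using cong_solve_coprime_int by blast
  let ?B = "\<lambda>z. {w \<in> Fp. int p dvd w ^ 2 + (z * i * (e - h) - b) * w + (1 + z * i * (c - e * b - f * z))}"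
  have "card (partners (e, f, g, h) b c) \<le> card (Sigma Fp ?B)"
  proof (rule card_inj_on_le)
    show "inj_on (\<lambda>(x, y, z, w). (z, w)) (partners (e, f, g, h) b c)"
    proof (rule inj_onI)
      fix B B' assume BB: "B \<in> partners (e, f, g, h) b c" "B' \<in> partners (e, f, g, h) b c"
        and eq: "(case B of (x, y, z, w) \<Rightarrow> (z, w)) = (case B' of (x, y, z, w) \<Rightarrow> (z, w))"
      obtain x y z w where B: "B = (x, y, z, w)" by (cases B) auto
      obtain x' y' where B': "B' = (x', y', z, w)" using eq B by (cases B') auto
      note 1 = BB[unfolded B B']
      then have "[x + w = x' + w] (mod int p)" by (auto simp: partners_def intro: cong_trans cong_sym)
      then have x: "x = x'" using 1 Fp_cong[of x x'] by (simp add: cong_add_rcancel partners_def)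
      have "[e * x + f * z + (g * y + h * w) = e * x' + f * z + (g * y' + h * w)] (mod int p)"
        using 1 by (auto simp: partners_def intro: cong_trans cong_sym)
      then have "[g * y = g * y'] (mod int p)" by (simp add: x cong_add_lcancel cong_add_rcancel)
      then have "y = y'" using 1 g cong_cancel Fp_cong by (auto simp: partners_def)
      with x show "B = B'" by (simp add: B B')
    qed
    show "(\<lambda>(x, y, z, w). (z, w)) ` partners (e, f, g, h) b c \<subseteq> Sigma Fp ?B"
    proof (rule image_subsetI)
      fix B assume B: "B \<in> partners (e, f, g, h) b c"
      obtain x y z w where B': "B = (x, y, z, w)" by (cases B) auto
      note P = B[unfolded B']
      have tr: "int p dvd x + w - b" and trA: "int p dvd e * x + f * z + (g * y + h * w) - c"
        and det: "int p dvd x * w - y * z - 1" and i': "int p dvd g * i - 1"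
        using P i by (auto simp: partners_def cong_iff_dvd_diff)
      \<comment> \<open>The combination of the three equations that eliminates \<open>x\<close> and \<open>y\<close>; \<open>i\<close> is the inverse of \<open>g\<close>.\<close>
      let ?Q = "w ^ 2 + (z * i * (e - h) - b) * w + (1 + z * i * (c - e * b - f * z))"
      have "?Q =
        (x + w - b) * w + (x + w - b) * (e * z * i)
        - (e * x + f * z + (g * y + h * w) - c) * (z * i) - (x * w - y * z - 1) + (g * i - 1) * (y * z)"
        by (simp add: algebra_simps power2_eq_square)
      moreover have "int p dvd \<dots>"
        by (intro dvd_add dvd_diff dvd_mult2 tr trA det i')
      ultimately have "int p dvd ?Q" by (simp only:)
      then show "(case B of (x, y, z, w) \<Rightarrow> (z, w)) \<in> Sigma Fp ?B"
        using P unfolding B' partners_def by simp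
    qed
  qed (auto intro!: finite_SigmaI intro: finite_subset[of _ Fp])
  also have "\<dots> \<le> card Fp * 2"
    by (rule card_Sigma_le) (use card_quadratic_le in \<open>auto intro: finite_subset[of _ Fp]\<close>)
  finally show ?thesis by simp
qed

lemma card_partners_transpose: "card (partners (e, f, g, h) b c) \<le> card (partners (e, g, f, h) b c)"
proof (rule card_inj_on_le[of "\<lambda>(x, y, z, w). (x, z, y, w)"])
  show "inj_on (\<lambda>(x, y, z, w). (x, z, y, w)) (partners (e, f, g, h) b c)" by (auto intro: inj_onI)
  show "(\<lambda>(x, y, z, w). (x, z, y, w)) ` partners (e, f, g, h) b c \<subseteq> partners (e, g, f, h) b c"
    by (auto simp: partners_def algebra_simps)
qed (rule finite_partners)

text \<open>The two trace conditions determine \<open>x\<close> and \<open>w\<close>, and the determinant then fixes \<open>y z\<close>.  If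
\<open>y \<noteq> 0\<close> it determines \<open>z\<close>; if \<open>y = 0\<close> there are at most \<open>p\<close> values of \<open>z\<close>.  The Boolean
distinguishes the two cases.\<close>

lemma card_partners_diagonal_le:
  assumes eh: "\<not> int p dvd h - e"
  shows "card (partners (e, 0, 0, h) b c) \<le> 2 * p"
proof -
  let ?\<phi> = "\<lambda>(x::int, y, z, w::int). if y = 0 then (False, z) else (True, y :: int)"
  have "card (partners (e, 0, 0, h) b c) \<le> card ((UNIV :: bool set) \<times> Fp)"
  proof (rule card_inj_on_le)
    show "inj_on ?\<phi> (partners (e, 0, 0, h) b c)"
    proof (rule inj_onI)
      fix B B' assume BB: "B \<in> partners (e, 0, 0, h) b c" "B' \<in> partners (e, 0, 0, h) b c"
        and eq': "?\<phi> B = ?\<phi> B'"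
      obtain x y z w where B: "B = (x, y, z, w)" by (cases B) auto
      obtain x' y' z' w' where B': "B' = (x', y', z', w')" by (cases B') auto
      note P = BB[unfolded B B'] and eq = eq'[unfolded B B']
      have xw: "[x + w = x' + w'] (mod int p)"
        and exw: "[e * x + h * w = e * x' + h * w'] (mod int p)"
        and det: "[x * w - y * z = x' * w' - y' * z'] (mod int p)"
        using P by (auto simp: partners_def intro: cong_trans cong_sym)
      have "[e * x + h * w - e * (x + w) = e * x' + h * w' - e * (x' + w')] (mod int p)"
        by (intro cong_diff cong_mult cong_refl xw exw)
      then have "[(h - e) * w = (h - e) * w'] (mod int p)" by (simp add: algebra_simps)
      then have w: "w = w'" using cong_cancel[OF eh] Fp_cong P by (auto simp: partners_def)
      then have x: "x = x'" using xw Fp_cong[of x x'] P by (simp add: partners_def cong_add_rcancel)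
      have y: "y = y'" using eq by (auto split: if_splits)
      have z: "z = z'"
      proof (cases "y = 0")
        case True
        then show ?thesis using eq y by simp
      next
        case False
        have "[y * z' = y * z] (mod int p)" using det by (simp add: x w y cong_iff_dvd_diff)
        then have "[y * z = y * z'] (mod int p)" by (rule cong_sym)
        moreover have "\<not> int p dvd y" using False Fp_dvd P by (auto simp: partners_def)
        ultimately show ?thesis using cong_cancel Fp_cong P by (auto simp: partners_def)
      qed
      show "B = B'" using w x y z by (simp add: B B')
    qed
  qed (auto simp: partners_def split: if_splits)
  then show ?thesis by (simp add: card_cartesian_product)
qed

lemma card_partners_le:
  assumes A: "A \<in> carrier (SL2 R)" "A \<notin> pm_one"
  shows "card (partners A b c) \<le> 2 * p"
proof -
  obtain e f g h where A': "A = (e, f, g, h)" by (cases A) auto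
  have Fp: "e \<in> Fp" "f \<in> Fp" "g \<in> Fp" "h \<in> Fp" using A by (auto simp: A' SL2_carrier_iff)
  consider "g \<noteq> 0" | "f \<noteq> 0" | "f = 0" "g = 0" "e \<noteq> h"
    using not_scalar A by (auto simp: A')
  then show ?thesis
  proof cases
    case 1
    then have "\<not> int p dvd g" using Fp_dvd[OF Fp(3)] by auto
    then show ?thesis unfolding A' by (rule card_partners_lower_le)
  next
    case 2
    then have "\<not> int p dvd f" using Fp_dvd[OF Fp(2)] by auto
    then show ?thesis unfolding A'
      using card_partners_transpose card_partners_lower_le order_trans by blast
  next
    case 3
    then have "\<not> int p dvd h - e" using Fp_cong[OF Fp(4,1)] by (auto simp: cong_iff_dvd_diff)
    then show ?thesis using card_partners_diagonal_le 3 by (simp add: A')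
  qed
qed

lemma in_partners:
  assumes "A \<in> carrier (SL2 R)" "B \<in> carrier (SL2 R)"
  shows "B \<in> partners A (trace B) (trace (A \<otimes>\<^bsub>SL2 R\<^esub> B))"
  using assms by (cases A, cases B) (auto simp: partners_def trace_def SL2_carrier_iff SL2_mult cong_def mod_simps)

lemma card_pairs_with_traces_le:
  assumes fin: "finite D"
  shows "card {(A, B). A \<in> carrier (SL2 R) \<and> B \<in> carrier (SL2 R) \<and> A \<notin> pm_one \<and>
      trace A \<in> D \<and> trace B \<in> D \<and> trace (A \<otimes>\<^bsub>SL2 R\<^esub> B) \<in> D}
    \<le> 4 * card D ^ 3 * p ^ 3" (is "card ?P \<le> _")
proof -
  define K where "K a = {A \<in> carrier (SL2 R). trace A = a} - pm_one" for a
  have finK: "finite (K a)" for a using finite_SL2 by (simp add: K_def)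
  have K: "card (K a) \<le> 2 * p ^ 2" for a
  proof -
    have "card (K a) \<le> card {A \<in> carrier (SL2 R). trace A = a}"
      unfolding K_def by (rule card_mono) (use finite_SL2 in auto)
    then show ?thesis using card_trace_fibre_le[of a] by simp
  qed
  let ?AS = "Sigma D K"
  let ?Q = "Sigma (?AS \<times> D \<times> D) (\<lambda>((a, A), b, c). partners A b c)"
  have finAS: "finite ?AS" using fin finK by blast
  have "finite (?AS \<times> D \<times> D)" using finAS fin by blast
  then have finQ: "finite ?Q" by (rule finite_SigmaI) (use finite_partners in auto)
  have "?P \<subseteq> (\<lambda>(((a, A), b, c), B). (A, B)) ` ?Q"
  proof clarify
    fix A B assume *: "A \<in> carrier (SL2 R)" "B \<in> carrier (SL2 R)" "A \<notin> pm_one"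
      "trace A \<in> D" "trace B \<in> D" "trace (A \<otimes>\<^bsub>SL2 R\<^esub> B) \<in> D"
    show "(A, B) \<in> (\<lambda>(((a, A), b, c), B). (A, B)) ` ?Q"
      by (rule image_eqI[of _ _ "(((trace A, A), trace B, trace (A \<otimes>\<^bsub>SL2 R\<^esub> B)), B)"])
        (use * in_partners in \<open>auto simp: K_def\<close>)
  qed
  then have "card ?P \<le> card ?Q" by (rule surj_card_le[OF finQ])
  also have "\<dots> \<le> card (?AS \<times> D \<times> D) * (2 * p)"
    by (rule card_Sigma_le) (use finAS fin finite_partners card_partners_le in \<open>auto simp: K_def\<close>)
  also have "\<dots> \<le> (card D * (2 * p ^ 2)) * card D * card D * (2 * p)"
    using card_Sigma_le[of D K "2 * p ^ 2", OF fin finK K] by (simp add: card_cartesian_product)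
  also have "\<dots> = 4 * card D ^ 3 * p ^ 3"
    by (simp add: power3_eq_cube power2_eq_square)
  finally show ?thesis .
qed

text \<open>The bound must allow for the orders being permuted, so every trace is confined to the union \<open>D\<close> of the
three root sets rather than to one of them.\<close>

lemma card_systems_of_type_le:
  assumes pos: "r > 1" "s > 1" "t > 1"
  shows "card (systems_of_type (PSL2 R) (r, s, t)) \<le> 4 * (r + s + t) ^ 3 * p ^ 3"
proof -
  interpret G: group "PSL2 R" by (rule group_PSL2)
  let ?G = "PSL2 R"
  let ?\<pi> = "\<lambda>A. pm_one #>\<^bsub>SL2 R\<^esub> A"
  define D where "D = order_traces r \<union> order_traces s \<union> order_traces t"
  have finD: "finite D" by (auto simp: D_def order_traces_def intro: finite_subset[of _ Fp])
  have cardD: "card D \<le> r + s + t"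
    using card_Un_le[of "order_traces r \<union> order_traces s" "order_traces t"]
      card_Un_le[of "order_traces r" "order_traces s"]
      card_order_traces_le[of r] card_order_traces_le[of s] card_order_traces_le[of t] pos
    unfolding D_def by linarith
  let ?P = "{(A, B). A \<in> carrier (SL2 R) \<and> B \<in> carrier (SL2 R) \<and> A \<notin> pm_one \<and>
      trace A \<in> D \<and> trace B \<in> D \<and> trace (A \<otimes>\<^bsub>SL2 R\<^esub> B) \<in> D}"
  let ?f = "\<lambda>(A, B). (?\<pi> A, ?\<pi> B, inv\<^bsub>?G\<^esub> (?\<pi> A \<otimes>\<^bsub>?G\<^esub> ?\<pi> B))"
  have lift: "A \<notin> pm_one \<and> trace A \<in> D" if A: "A \<in> carrier (SL2 R)" and o: "G.ord (?\<pi> A) \<in> {r, s, t}" for A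
  proof -
    have c: "?\<pi> A \<in> carrier ?G" using A by (auto simp: PSL2_eq carrier_FactGroup)
    have "?\<pi> A \<noteq> \<one>\<^bsub>?G\<^esub>" using o pos by auto
    then have "A \<notin> pm_one" using coset_eq_one_iff[OF A] by simp
    moreover have "trace A \<in> order_traces (G.ord (?\<pi> A))"
      by (rule trace_of_finite_order) (use A c o pos \<open>A \<notin> pm_one\<close> in auto)
    ultimately show ?thesis using o by (auto simp: D_def)
  qed
  have "systems_of_type ?G (r, s, t) \<subseteq> ?f ` ?P"
  proof
    fix T assume T: "T \<in> systems_of_type ?G (r, s, t)"
    obtain x1 x2 x3 where T': "T = (x1, x2, x3)" by (cases T) auto
    have x: "x1 \<in> carrier ?G" "x2 \<in> carrier ?G" "x3 \<in> carrier ?G"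
      and prod: "x1 \<otimes>\<^bsub>?G\<^esub> x2 \<otimes>\<^bsub>?G\<^esub> x3 = \<one>\<^bsub>?G\<^esub>"
      and ords: "{#G.ord x1, G.ord x2, G.ord x3#} = {#r, s, t#}"
      using T by (auto simp: T' systems_of_type_def spherical_system_def unordered_type_def unordered_def)
    have "{G.ord x1, G.ord x2, G.ord x3} = {r, s, t}"
      using arg_cong[OF ords, of set_mset] by simp
    then have o: "G.ord x1 \<in> {r, s, t}" "G.ord x2 \<in> {r, s, t}" "G.ord x3 \<in> {r, s, t}" by blast+
    obtain A where A: "A \<in> carrier (SL2 R)" "x1 = ?\<pi> A" using x(1) by (rule PSL2_carrierE)
    obtain B where B: "B \<in> carrier (SL2 R)" "x2 = ?\<pi> B" using x(2) by (rule PSL2_carrierE)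
    have x3: "x3 = inv\<^bsub>?G\<^esub> (x1 \<otimes>\<^bsub>?G\<^esub> x2)"
      using x prod by (metis G.inv_equality G.inv_inv G.m_closed)
    have AB: "?\<pi> (A \<otimes>\<^bsub>SL2 R\<^esub> B) = x1 \<otimes>\<^bsub>?G\<^esub> x2"
      using A B by (simp add: PSL2_eq PSL.rcos_sum)
    have "G.ord (?\<pi> (A \<otimes>\<^bsub>SL2 R\<^esub> B)) = G.ord x3"
      unfolding AB using x by (simp add: x3)
    then have "(A, B) \<in> ?P" using A B lift o by simp
    then show "T \<in> ?f ` ?P" using A B x3 by (force simp: T')
  qed
  moreover have "finite ?P"
    by (rule finite_subset[of _ "carrier (SL2 R) \<times> carrier (SL2 R)"]) (use finite_SL2 in auto)
  ultimately have "card (systems_of_type ?G (r, s, t)) \<le> card ?P" by (intro surj_card_le)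
  also have "\<dots> \<le> 4 * card D ^ 3 * p ^ 3" by (rule card_pairs_with_traces_le[OF finD])
  also have "\<dots> \<le> 4 * (r + s + t) ^ 3 * p ^ 3"
    using cardD by (intro mult_le_mono power_mono) auto
  finally show ?thesis .
qed

end

lemma hyperbolic_gt_one:
  assumes "hyperbolic (r, s, t)"
  shows "r > 1" "s > 1" "t > 1"
proof -
  have pos: "r > 0" "s > 0" "t > 0" and less: "1 / real r + 1 / real s + 1 / real t < 1"
    using assms by (auto simp: hyperbolic_def)
  have "1 / real r > 0" "1 / real s > 0" "1 / real t > 0" using pos by auto
  then have "1 / real r < 1" "1 / real s < 1" "1 / real t < 1" using less by linarith+
  then show "r > 1" "s > 1" "t > 1" using pos by auto
qed

theorem theorem1p9:
  fixes \<tau>1 \<tau>2 :: "nat \<times> nat \<times> nat"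
  assumes "hyperbolic \<tau>1" and "hyperbolic \<tau>2"
  shows "\<exists>c::nat. \<forall>p::nat. prime p \<and> odd p \<longrightarrow>
           num_beauville (PSL2 (residue_ring (int p))) \<tau>1 \<tau>2 \<le> c"
proof -
  obtain r s t where \<tau>1: "\<tau>1 = (r, s, t)" by (cases \<tau>1) auto
  obtain u v w where \<tau>2: "\<tau>2 = (u, v, w)" by (cases \<tau>2) auto
  define M where "M = 4 * (r + s + t) ^ 3"
  define N where "N = 4 * (u + v + w) ^ 3"
  have "num_beauville (PSL2 (residue_ring (int p))) \<tau>1 \<tau>2 \<le> 9 * (M * N)" if p: "prime p" "odd p" for p
  proof -
    let ?G = "PSL2 (residue_ring (int p))"
    interpret residues_prime p "residue_ring (int p)" by unfold_locales (rule p)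
    interpret G: group ?G by (rule group_PSL2)
    let ?h = "num_beauville ?G \<tau>1 \<tau>2"
    \<comment> \<open>The factor \<open>p^6\<close> cancels between \<open>|G|^2\<close> and the product of the numbers of systems.\<close>
    have "?h * (p ^ 3) ^ 2 \<le> ?h * (3 * Coset.order ?G) ^ 2"
      using order_PSL2_ge[OF p(2)] by (intro mult_le_mono power_mono) auto
    also have "\<dots> = 9 * (?h * Coset.order ?G ^ 2)" by (simp add: power_mult_distrib)
    also have "\<dots> \<le> 9 * (card (systems_of_type ?G \<tau>1) * card (systems_of_type ?G \<tau>2))"
      using G.num_beauville_le[OF finite_PSL2 PSL2_centre_trivial[OF p(2)]] by simp
    also have "\<dots> \<le> 9 * ((M * p ^ 3) * (N * p ^ 3))"
      using card_systems_of_type_le hyperbolic_gt_one assms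
      by (intro mult_le_mono) (simp_all add: \<tau>1 \<tau>2 M_def N_def)
    also have "\<dots> = 9 * (M * N) * (p ^ 3) ^ 2" by (simp add: power2_eq_square)
    finally show ?thesis using p_pos by simp
  qed
  then show ?thesis by blast
qed

end
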